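(* Let $K\subset\mathbb{R}^3$ be a strictly convex body with $C^2$-boundary and positive Gaussian curvature on $\partial K$. Fix $\nu\in\mathbb{S}^2$, choose an oriented orthonormal basis $\{e_1,e_2\}$ of $\nu^\perp$, and let $m=\min_{x\in K}x\cdot\nu$, $M=\max_{x\in K}x\cdot\nu$, $u(\theta)=\cos\theta\,e_1+\sin\theta\,e_2$, $u^\perp=u^\perp(\theta)=-\sin\theta\,e_1+\cos\theta\,e_2$. For $(\theta,p)\in\mathbb{S}^1\times(m,M)$ let $$H(\theta,p)=h_\nu(u(\theta),p)=\inf_{\lambda\in\mathbb{R}}\bigl(h_K(u(\theta)+\lambda\nu)-\lambda p\bigr),$$ let $\lambda=\lambda(\theta,p)$ be the unique minimizer in this infimum, and put $$\mathcal{A}[H]=(H_{\theta\theta}+H)H_{pp}-(H_{\theta p})^2,\qquad v:=u(\theta)+\lambda\nu,\qquad \omega:=\frac{v}{|v|}\in\mathbb{S}^2 .$$ Then $$\mathcal{A}[H]=-(1+\lambda^2)\,\frac{Q_\omega[u^\perp,u^\perp]}{Q_\omega[\tau,\tau]},$$ where $Q_\omega$ is the spherical curvature matrix of $K$ at $\omega$ and $$\tau:=\frac{\nu-\lambda u(\theta)}{\sqrt{1+\lambda^2}}\in T_\omega\mathbb{S}^2$$ is the unit tangent vector orthogonal to $u^\perp$. In particular, if $u^\perp$ and $\tau$ are principal directions at $\omega$, then $Q_\omega[u^\perp,u^\perp]=r_1$ and $Q_\omega[\tau,\tau]=r_2$, where $r_i=1/\kappa_i$ are the corresponding principal radii of curvature,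 and hence $$\mathcal{A}[H]=-(1+\lambda^2)\frac{r_1}{r_2}=-(1+\lambda^2)\frac{\kappa_2}{\kappa_1}.$$
   Context: The support function is $h_K(v)=\sup_{x\in K}x\cdot v$, $v\in\mathbb{R}^3$, and $\bar h_K=h_K|_{\mathbb{S}^2}$. For $\nu\in\mathbb{S}^2$ write $\nu^\perp=\{x\in\mathbb{R}^3:x\cdot\nu=0\}$. The slicing support function is $h_\nu(u,p)=\sup\{x\cdot u: x\in K,\ x\cdot\nu=p\}$ for $u\in\nu^\perp$. Subscripts on $H$ denote partial derivatives. For $\omega\in\mathbb{S}^2$, $T_\omega\mathbb{S}^2=\{v\in\mathbb{R}^3:v\cdot\omega=0\}$. The spherical Hessian of a function $h$ on $\mathbb{S}^2$ is $\nabla^2_{\mathbb{S}^2}h(X,Y)=X(Yh)-(\nabla^{\mathbb{S}^2}_XY)h$, where $\nabla^{\mathbb{S}^2}$ is the Levi-Civita connection of the round metric. The spherical curvature matrix of $K$ at $\omega$ is the symmetric bilinear form $Q_\omega=\nabla^2_{\mathbb{S}^2}\bar h_K(\omega)+\bar h_K(\omega)I$ on $T_\omega\mathbb{S}^2$ ($I$ the identity, identified with the metric); $Q_\omega[X,Y]$ denotes its value on $(X,Y)$. Principal directions at $\omega$ mean principal directions of $\partial K$ at the point $N^{-1}(\omega)$, where $N:\partial K\to\mathbb{S}^2$ is the outward Gauss map (with the tangent planes identified); the principal curvatures $\kappa_1,\kappa_2>0$ are the eigenvalues of $dN$ at that point, $\kappa_1$ corresponding to $u^\perp$ and $\kappa_2$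 to $\tau$. *)

theory Defs
  imports "HOL-Analysis.Analysis"
begin

subsection \<open>Convex bodies with twice continuously differentiable boundary\<close>

definition C2_on :: "'a::real_normed_vector set \<Rightarrow> ('a \<Rightarrow> real) \<Rightarrow> bool" where
  "C2_on S f \<longleftrightarrow> (\<exists>(f' :: 'a \<Rightarrow> 'a \<Rightarrow>\<^sub>L real) (f'' :: 'a \<Rightarrow> 'a \<Rightarrow>\<^sub>L ('a \<Rightarrow>\<^sub>L real)).
     (\<forall>x\<in>S. (f has_derivative blinfun_apply (f' x)) (at x)) \<and>
     (\<forall>x\<in>S. (f' has_derivative blinfun_apply (f'' x)) (at x)) \<and>
     continuous_on S f'')"

definition strictly_convex_body :: "'a::euclidean_space set \<Rightarrow> bool" where
  "strictly_convex_body K \<longleftrightarrow>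
     compact K \<and> convex K \<and> interior K \<noteq> {} \<and>
     (\<forall>x\<in>K. \<forall>y\<in>K. x \<noteq> y \<longrightarrow> open_segment x y \<subseteq> interior K)"

text \<open>Near each of its boundary points, the body is the sublevel set of a regular \<open>C\<^sup>2\<close> function.\<close>

definition C2_boundary :: "'a::euclidean_space set \<Rightarrow> bool" where
  "C2_boundary K \<longleftrightarrow> (\<forall>x\<in>frontier K. \<exists>U g. open U \<and> x \<in> U \<and> C2_on U g \<and>
     (\<forall>y\<in>U. \<not> (g has_derivative (\<lambda>_. 0)) (at y)) \<and>
     K \<inter> U = {y \<in> U. g y \<le> 0})"

text \<open>The outward unit normal at a boundary point of a convex body, unique if the boundary is \<open>C\<^sup>1\<close>.\<close>

definition gauss_map :: "(real^3) set \<Rightarrow> real^3 \<Rightarrow> real^3" where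
  "gauss_map K x = (THE n. norm n = 1 \<and> (\<forall>y\<in>K. (y - x) \<bullet> n \<le> 0))"

text \<open>The differential \<open>dN\<close> of the Gauss map.  A derivative within the boundary surface is
  determined on tangent vectors only; below it is applied to tangent vectors only.\<close>

definition weingarten :: "(real^3) set \<Rightarrow> real^3 \<Rightarrow> real^3 \<Rightarrow> real^3" where
  "weingarten K x = frechet_derivative (gauss_map K) (at x within frontier K)"

text \<open>The Gaussian curvature is the determinant of \<open>dN\<close> on the tangent plane, computed here as the
  determinant of the endomorphism of \<open>\<real>\<^sup>3\<close> that acts as \<open>dN\<close> on the tangent plane and
  fixes the normal line.\<close>

definition gauss_curvature :: "(real^3) set \<Rightarrow> real^3 \<Rightarrow> real" where
  "gauss_curvature K x =
     (let n = gauss_map K x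
      in det (matrix (\<lambda>v. weingarten K x (v - (v \<bullet> n) *\<^sub>R n) + (v \<bullet> n) *\<^sub>R n)))"

definition principal_direction :: "(real^3) set \<Rightarrow> real^3 \<Rightarrow> real^3 \<Rightarrow> real \<Rightarrow> bool" where
  "principal_direction K x X k \<longleftrightarrow>
     X \<noteq> 0 \<and> X \<bullet> gauss_map K x = 0 \<and> weingarten K x X = k *\<^sub>R X"


subsection \<open>Support functions\<close>

definition support_fun :: "(real^3) set \<Rightarrow> real^3 \<Rightarrow> real" where
  "support_fun K v = (SUP x\<in>K. x \<bullet> v)"

definition slice_support :: "(real^3) set \<Rightarrow> real^3 \<Rightarrow> real^3 \<Rightarrow> real \<Rightarrow> real" where
  "slice_support K \<nu> u p = (SUP x\<in>{x \<in> K. x \<bullet> \<nu> = p}. x \<bullet> u)"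


subsection \<open>Spherical Hessian and spherical curvature matrix\<close>

text \<open>Derivative at \<open>\<omega>\<close>, in the direction of a tangent vector, of a function given on the unit
  sphere; see \<open>sph_deriv_eq\<close> below for uniqueness.\<close>

definition sph_deriv :: "(real^3 \<Rightarrow> 'b::real_normed_vector) \<Rightarrow> real^3 \<Rightarrow> real^3 \<Rightarrow> 'b" where
  "sph_deriv f \<omega> X = frechet_derivative f (at \<omega> within sphere 0 1) X"

text \<open>The Levi-Civita connection \<open>\<nabla>\<^sub>X Y\<close> of the round metric: the tangential part of the
  ambient derivative.  The lemmas \<open>sph_cov_metric\<close> and \<open>sph_cov_torsion_free\<close> below give the two
  characterizing properties.\<close>

definition sph_cov :: "(real^3 \<Rightarrow> real^3) \<Rightarrow> real^3 \<Rightarrow> real^3 \<Rightarrow> real^3" where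
  "sph_cov Y \<omega> X = sph_deriv Y \<omega> X - (sph_deriv Y \<omega> X \<bullet> \<omega>) *\<^sub>R \<omega>"

text \<open>\<open>X(Yh) - (\<nabla>\<^sub>X Y)h\<close> at \<open>\<omega>\<close>, for a tangent vector \<open>X\<close> and a tangent vector field \<open>Y\<close>.\<close>

definition sph_hessian_field ::
  "(real^3 \<Rightarrow> real) \<Rightarrow> real^3 \<Rightarrow> real^3 \<Rightarrow> (real^3 \<Rightarrow> real^3) \<Rightarrow> real" where
  "sph_hessian_field h \<omega> X Y =
     sph_deriv (\<lambda>z. sph_deriv h z (Y z)) \<omega> X - sph_deriv h \<omega> (sph_cov Y \<omega> X)"

definition tangent_field :: "real^3 \<Rightarrow> real^3 \<Rightarrow> real^3" where
  "tangent_field Y z = Y - (Y \<bullet> z) *\<^sub>R z"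

text \<open>The Hessian is a tensor, so a tangent vector \<open>Y\<close> at \<open>\<omega>\<close> may be extended to any
  tangent field; lemma \<open>sph_hessian_extension\<close> below shows that the choice does not matter.\<close>

definition sph_hessian :: "(real^3 \<Rightarrow> real) \<Rightarrow> real^3 \<Rightarrow> real^3 \<Rightarrow> real^3 \<Rightarrow> real" where
  "sph_hessian h \<omega> X Y = sph_hessian_field h \<omega> X (tangent_field Y)"

definition sph_curvature :: "(real^3) set \<Rightarrow> real^3 \<Rightarrow> real^3 \<Rightarrow> real^3 \<Rightarrow> real" where
  "sph_curvature K \<omega> X Y =
     sph_hessian (support_fun K) \<omega> X Y + support_fun K \<omega> * (X \<bullet> Y)"

lemma sph_deriv_eq:
  fixes f :: "real^3 \<Rightarrow> 'b::real_normed_vector"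
  assumes f: "(f has_derivative D) (at \<omega> within sphere 0 1)"
    and \<omega>: "norm \<omega> = 1" and X: "X \<bullet> \<omega> = 0"
  shows "sph_deriv f \<omega> X = D X"
proof -
  have *: "D1 X = D2 X"
    if 1: "(f has_derivative D1) (at \<omega> within sphere 0 1)"
      and 2: "(f has_derivative D2) (at \<omega> within sphere 0 1)" for D1 D2
  proof (cases "X = 0")
    case True
    then show ?thesis
      using has_derivative_linear[OF 1] has_derivative_linear[OF 2] by (simp add: linear_0)
  next
    case False
    define Y where "Y = X /\<^sub>R norm X"
    have Y: "Y \<bullet> \<omega> = 0" "Y \<bullet> Y = 1"
      using X False by (auto simp: Y_def dot_square_norm power2_eq_square)
    define c where "c t = cos t *\<^sub>R \<omega> + sin t *\<^sub>R Y" for t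
    have c0: "c 0 = \<omega>" by (simp add: c_def)
    have "\<omega> \<bullet> \<omega> = 1" using \<omega> by (simp add: norm_eq_1)
    then have "c t \<bullet> c t = 1" for t
      using Y by (simp add: c_def inner_add_left inner_add_right inner_commute
          flip: power2_eq_square)
    then have csph: "range c \<subseteq> sphere 0 1" by (auto simp: norm_eq_1)
    have dc: "(c has_derivative (\<lambda>t. t *\<^sub>R Y)) (at 0)"
      unfolding c_def by (auto intro!: derivative_eq_intros)
    have comp: "(f \<circ> c has_derivative D \<circ> (\<lambda>t. t *\<^sub>R Y)) (at 0)"
      if "(f has_derivative D) (at \<omega> within sphere 0 1)" for D
    proof (rule diff_chain_within[OF dc])
      show "(f has_derivative D) (at (c 0) within range c)"
        unfolding c0 by (rule has_derivative_subset[OF that csph])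
    qed
    have "D1 \<circ> (\<lambda>t. t *\<^sub>R Y) = D2 \<circ> (\<lambda>t. t *\<^sub>R Y)"
      by (rule has_derivative_unique[OF comp[OF 1] comp[OF 2]])
    then have "D1 (norm X *\<^sub>R Y) = D2 (norm X *\<^sub>R Y)" by (metis comp_apply)
    then show ?thesis using False by (simp add: Y_def)
  qed
  have "(f has_derivative frechet_derivative f (at \<omega> within sphere 0 1)) (at \<omega> within sphere 0 1)"
    using f by (metis differentiableI frechet_derivative_works)
  from *[OF this f] show ?thesis by (simp add: sph_deriv_def)
qed

lemma sph_deriv_inner:
  assumes "Y differentiable (at \<omega> within sphere 0 1)" "Z differentiable (at \<omega> within sphere 0 1)"
    and "norm \<omega> = 1" "X \<bullet> \<omega> = 0"
  shows "sph_deriv (\<lambda>z. Y z \<bullet> Z z) \<omega> X = sph_deriv Y \<omega> X \<bullet> Z \<omega> + Y \<omega> \<bullet> sph_deriv Z \<omega> X"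
proof -
  obtain A B where A: "(Y has_derivative A) (at \<omega> within sphere 0 1)"
    and B: "(Z has_derivative B) (at \<omega> within sphere 0 1)"
    using assms(1,2) by (auto simp: differentiable_def)
  have "((\<lambda>z. Y z \<bullet> Z z) has_derivative (\<lambda>h. Y \<omega> \<bullet> B h + A h \<bullet> Z \<omega>)) (at \<omega> within sphere 0 1)"
    by (rule has_derivative_inner[OF A B])
  from sph_deriv_eq[OF this] sph_deriv_eq[OF A] sph_deriv_eq[OF B] assms(3,4)
  show ?thesis by simp
qed

lemma sph_cov_metric:
  assumes "Y differentiable (at \<omega> within sphere 0 1)" "Z differentiable (at \<omega> within sphere 0 1)"
    and "Y \<omega> \<bullet> \<omega> = 0" "Z \<omega> \<bullet> \<omega> = 0" and "norm \<omega> = 1" "X \<bullet> \<omega> = 0"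
  shows "sph_deriv (\<lambda>z. Y z \<bullet> Z z) \<omega> X = sph_cov Y \<omega> X \<bullet> Z \<omega> + Y \<omega> \<bullet> sph_cov Z \<omega> X"
  using assms sph_deriv_inner[of Y \<omega> Z X]
  by (simp add: sph_cov_def inner_diff_left inner_diff_right inner_commute)

lemma sph_deriv_normal_part:
  assumes Y: "Y differentiable (at \<omega> within sphere 0 1)"
    and t: "\<And>z. norm z = 1 \<Longrightarrow> Y z \<bullet> z = 0" and \<omega>: "norm \<omega> = 1" and X: "X \<bullet> \<omega> = 0"
  shows "sph_deriv Y \<omega> X \<bullet> \<omega> = - (Y \<omega> \<bullet> X)"
proof -
  have "((\<lambda>z. Y z \<bullet> z) has_derivative (\<lambda>_. 0)) (at \<omega> within sphere 0 1)"
    by (rule has_derivative_transform[where f = "\<lambda>_. 0"]) (use t \<omega> in auto)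
  from sph_deriv_eq[OF this \<omega> X] have "sph_deriv (\<lambda>z. Y z \<bullet> z) \<omega> X = 0" .
  moreover have "sph_deriv (\<lambda>z. z) \<omega> X = X"
    by (rule sph_deriv_eq[OF _ \<omega> X]) (rule has_derivative_ident)
  ultimately show ?thesis
    using sph_deriv_inner[OF Y _ \<omega> X, of "\<lambda>z. z"] by simp
qed

text \<open>The right-hand side is the Lie bracket \<open>[X, Y]\<close>.\<close>

lemma sph_cov_torsion_free:
  assumes "X differentiable (at \<omega> within sphere 0 1)" "Y differentiable (at \<omega> within sphere 0 1)"
    and "\<And>z. norm z = 1 \<Longrightarrow> X z \<bullet> z = 0" "\<And>z. norm z = 1 \<Longrightarrow> Y z \<bullet> z = 0" "norm \<omega> = 1"
  shows "sph_cov Y \<omega> (X \<omega>) - sph_cov X \<omega> (Y \<omega>) = sph_deriv Y \<omega> (X \<omega>) - sph_deriv X \<omega> (Y \<omega>)"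
  using assms sph_deriv_normal_part[of Y \<omega> "X \<omega>"] sph_deriv_normal_part[of X \<omega> "Y \<omega>"]
  by (simp add: sph_cov_def inner_commute)

text \<open>\<open>G\<close> is the spherical gradient of \<open>h\<close>.\<close>

lemma sph_hessian_field_gradient:
  assumes h: "\<And>z. norm z = 1 \<Longrightarrow> (h has_derivative (\<lambda>v. G z \<bullet> v)) (at z within sphere 0 1)"
    and G: "\<And>z. norm z = 1 \<Longrightarrow> G z \<bullet> z = 0" "G differentiable (at \<omega> within sphere 0 1)"
    and Y: "\<And>z. norm z = 1 \<Longrightarrow> Y z \<bullet> z = 0" "Y differentiable (at \<omega> within sphere 0 1)"
    and \<omega>: "norm \<omega> = 1" and X: "X \<bullet> \<omega> = 0"
  shows "sph_hessian_field h \<omega> X Y = sph_deriv G \<omega> X \<bullet> Y \<omega>"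
proof -
  have eq: "sph_deriv h z (Y z) = G z \<bullet> Y z" if "norm z = 1" for z
    by (rule sph_deriv_eq[OF h]) (use that Y in auto)
  obtain A B where "(G has_derivative A) (at \<omega> within sphere 0 1)"
    and "(Y has_derivative B) (at \<omega> within sphere 0 1)"
    using G(2) Y(2) unfolding differentiable_def by blast
  from has_derivative_inner[OF this]
  obtain D where D: "((\<lambda>z. G z \<bullet> Y z) has_derivative D) (at \<omega> within sphere 0 1)"
    by blast
  have "((\<lambda>z. sph_deriv h z (Y z)) has_derivative D) (at \<omega> within sphere 0 1)"
    by (rule has_derivative_transform[OF _ _ D]) (use eq \<omega> in auto)
  then have "sph_deriv (\<lambda>z. sph_deriv h z (Y z)) \<omega> X = sph_deriv (\<lambda>z. G z \<bullet> Y z) \<omega> X"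
    using sph_deriv_eq[OF _ \<omega> X] D by metis
  also have "\<dots> = sph_deriv G \<omega> X \<bullet> Y \<omega> + G \<omega> \<bullet> sph_deriv Y \<omega> X"
    by (rule sph_deriv_inner) (use G Y \<omega> X in auto)
  finally have 1: "sph_deriv (\<lambda>z. sph_deriv h z (Y z)) \<omega> X = \<dots>" .
  have "sph_cov Y \<omega> X \<bullet> \<omega> = 0"
    using \<omega> by (simp add: sph_cov_def inner_diff_left dot_square_norm)
  then have "sph_deriv h \<omega> (sph_cov Y \<omega> X) = G \<omega> \<bullet> sph_cov Y \<omega> X"
    by (rule sph_deriv_eq[OF h[OF \<omega>] \<omega>])
  also have "\<dots> = G \<omega> \<bullet> sph_deriv Y \<omega> X"
    using G(1)[OF \<omega>] by (simp add: sph_cov_def inner_diff_right)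
  finally show ?thesis using 1 by (simp add: sph_hessian_field_def)
qed

lemma tangent_field_tangent: "norm z = 1 \<Longrightarrow> tangent_field Y z \<bullet> z = 0"
  by (simp add: tangent_field_def inner_diff_left dot_square_norm)

lemma tangent_field_eq: "Y \<bullet> \<omega> = 0 \<Longrightarrow> tangent_field Y \<omega> = Y"
  by (simp add: tangent_field_def)

lemma tangent_field_differentiable: "tangent_field Y differentiable (at \<omega> within S)"
  unfolding tangent_field_def differentiable_def
  by (rule exI) (auto intro!: derivative_eq_intros)

lemma sph_hessian_extension:
  assumes "\<And>z. norm z = 1 \<Longrightarrow> (h has_derivative (\<lambda>v. G z \<bullet> v)) (at z within sphere 0 1)"
    and "\<And>z. norm z = 1 \<Longrightarrow> G z \<bullet> z = 0" "G differentiable (at \<omega> within sphere 0 1)"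
    and "\<And>z. norm z = 1 \<Longrightarrow> Y z \<bullet> z = 0" "Y differentiable (at \<omega> within sphere 0 1)"
    and "norm \<omega> = 1" "X \<bullet> \<omega> = 0"
  shows "sph_hessian_field h \<omega> X Y = sph_hessian h \<omega> X (Y \<omega>)"
  unfolding sph_hessian_def
  using sph_hessian_field_gradient[OF assms(1-5) assms(6,7)]
    sph_hessian_field_gradient[OF assms(1-3) tangent_field_tangent tangent_field_differentiable assms(6,7)]
    tangent_field_eq[OF assms(4)[OF assms(6)]]
  by simp


subsection \<open>The operator \<open>(H\<^sub>\<theta>\<^sub>\<theta> + H) H\<^sub>p\<^sub>p - H\<^sub>\<theta>\<^sub>p\<^sup>2\<close>\<close>

definition partial_fst :: "(real \<Rightarrow> real \<Rightarrow> real) \<Rightarrow> real \<Rightarrow> real \<Rightarrow> real" where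
  "partial_fst H \<theta> p = deriv (\<lambda>t. H t p) \<theta>"

definition partial_snd :: "(real \<Rightarrow> real \<Rightarrow> real) \<Rightarrow> real \<Rightarrow> real \<Rightarrow> real" where
  "partial_snd H \<theta> p = deriv (\<lambda>q. H \<theta> q) p"

definition op_A :: "(real \<Rightarrow> real \<Rightarrow> real) \<Rightarrow> real \<Rightarrow> real \<Rightarrow> real" where
  "op_A H \<theta> p = (partial_fst (partial_fst H) \<theta> p + H \<theta> p) * partial_snd (partial_snd H) \<theta> p - (partial_snd (partial_fst H) \<theta> p)\<^sup>2"

end

theory Submission
  imports Defs
begin

text \<open>
  By strict convexity the support function \<open>h\<close> has a unique support point in every direction, which is
  its gradient. If \<open>\<phi>\<close> is a local defining function with unit normal \<open>n = \<nabla>\<phi> / \<bar>\<nabla>\<phi>\<bar>\<close>, the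
  support point inverts \<open>(1 + \<phi>) n\<close>, whose derivative is invertible on the boundary because the curvature is
  positive; so \<open>h\<close> is \<open>C\<^sup>2\<close>, and its Hessian \<open>B\<close> is positive definite transversally to the radial
  direction. On tangent vectors to the sphere it is \<open>Q\<close>, and it inverts the differential of the Gauss map.

  The minimizer \<open>\<lambda>\<close> solves \<open>\<nabla>h(u + \<lambda>\<nu>) \<bullet> \<nu> = p\<close>. Differentiating this equation gives
  \<open>H\<^sub>p = -\<lambda>\<close>, \<open>H\<^sub>\<theta> = \<nabla>h \<bullet> u\<^sup>\<bottom>\<close> and, with \<open>a = B(u\<^sup>\<bottom>, u\<^sup>\<bottom>)\<close>,
  \<open>b = B(u\<^sup>\<bottom>, \<nu>)\<close>, \<open>c = B(\<nu>, \<nu>)\<close>,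
  \<open>H\<^sub>\<theta>\<^sub>\<theta> + H = a - b\<^sup>2 / c\<close>, \<open>H\<^sub>\<theta>\<^sub>p = b / c\<close>, \<open>H\<^sub>p\<^sub>p = -1 / c\<close>. Hence the
  operator equals \<open>-a / c\<close>, and \<open>c\<close> is expressed through \<open>\<tau>\<close> because \<open>B\<close> vanishes on \<open>u + \<lambda>\<nu>\<close>.
\<close>

subsection \<open>Derivatives\<close>

text \<open>The mean value theorem reduces the second difference to \<open>t\<close> times an
  increment of the gradient paired with \<open>b\<close>, and differentiability of \<open>g\<close>
  at \<open>v\<close> controls that increment. The second difference is symmetric in
  \<open>a\<close> and \<open>b\<close>, whence the symmetry of \<open>D\<close>.\<close>

lemma second_difference_bound:
  fixes h :: "'a::real_inner \<Rightarrow> real"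
  assumes "open S" "v \<in> S"
    and h: "\<And>w. w \<in> S \<Longrightarrow> (h has_derivative (\<lambda>d. g w \<bullet> d)) (at w)"
    and g: "(g has_derivative D) (at v)"
    and e: "e > 0"
  shows "\<exists>d>0. \<forall>t. 0 < t \<and> t < d \<longrightarrow>
    \<bar>h (v + t *\<^sub>R a + t *\<^sub>R b) - h (v + t *\<^sub>R a) - h (v + t *\<^sub>R b) + h v - t\<^sup>2 * (D a \<bullet> b)\<bar> \<le> e * t\<^sup>2"
proof -
  \<comment> \<open>The summand 1 keeps \<open>c\<close> positive when \<open>a\<close> and
    \<open>b\<close> vanish. Two expansion errors of size \<open>e' * (t * c)\<close>, paired with
    \<open>b\<close>, then add up to at most \<open>e * t\<close>.\<close>
  define c where "c = norm a + norm b + 1"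
  have c: "c > 0" "norm a \<le> c" "norm b \<le> c" by (auto simp: c_def intro: add_nonneg_pos)
  interpret D: bounded_linear D by (rule has_derivative_bounded_linear[OF g])
  define e' where "e' = e / (2 * c * c)"
  have "e' > 0" using e c by (simp add: e'_def)
  then obtain d1 where "d1 > 0" and d1: "\<And>w. norm (w - v) < d1 \<Longrightarrow>
      norm (g w - g v - D (w - v)) \<le> e' * norm (w - v)"
    using g unfolding has_derivative_at_alt by metis
  obtain r where "r > 0" and r: "ball v r \<subseteq> S"
    using assms(1,2) by (meson open_contains_ball)
  define d where "d = min d1 r / c"
  have "d > 0" using \<open>d1 > 0\<close> \<open>r > 0\<close> c by (simp add: d_def)
  moreover have "\<bar>h (v + t *\<^sub>R a + t *\<^sub>R b) - h (v + t *\<^sub>R a) - h (v + t *\<^sub>R b) + h v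
      - t\<^sup>2 * (D a \<bullet> b)\<bar> \<le> e * t\<^sup>2" if t: "0 < t" "t < d" for t
  proof -
    have tc: "t * c < d1" "t * c < r"
      using t c by (auto simp: d_def pos_less_divide_eq)
    have nn: "norm (p *\<^sub>R a + q *\<^sub>R b) \<le> t * c" if "0 \<le> p" "p \<le> t" "0 \<le> q" "q \<le> t" for p q
    proof -
      have "norm (p *\<^sub>R a + q *\<^sub>R b) \<le> p * norm a + q * norm b"
        using norm_triangle_ineq[of "p *\<^sub>R a" "q *\<^sub>R b"] that by simp
      also have "\<dots> \<le> t * norm a + t * norm b"
        using that by (intro add_mono mult_right_mono) auto
      also have "\<dots> \<le> t * c" using t by (simp add: c_def algebra_simps)
      finally show ?thesis .
    qed
    have inS: "v + p *\<^sub>R a + q *\<^sub>R b \<in> S" if "0 \<le> p" "p \<le> t" "0 \<le> q" "q \<le> t" for p q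
    proof -
      have "norm (p *\<^sub>R a + q *\<^sub>R b) < r" using nn[OF that] tc by linarith
      then have "v + (p *\<^sub>R a + q *\<^sub>R b) \<in> ball v r"
        by (simp only: mem_ball dist_norm diff_add_cancel norm_minus_commute[of v]) simp
      then show ?thesis using r by (auto simp: add.assoc)
    qed
    have est: "norm (g (v + p *\<^sub>R a + q *\<^sub>R b) - g v - D (p *\<^sub>R a + q *\<^sub>R b)) \<le> e' * (t * c)"
      if "0 \<le> p" "p \<le> t" "0 \<le> q" "q \<le> t" for p q
    proof -
      have eq: "v + p *\<^sub>R a + q *\<^sub>R b - v = p *\<^sub>R a + q *\<^sub>R b" by simp
      have "norm (v + p *\<^sub>R a + q *\<^sub>R b - v) < d1" unfolding eq using nn[OF that] tc by linarith
      from d1[OF this] have "norm (g (v + p *\<^sub>R a + q *\<^sub>R b) - g v - D (p *\<^sub>R a + q *\<^sub>R b))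
          \<le> e' * norm (p *\<^sub>R a + q *\<^sub>R b)" unfolding eq .
      also have "\<dots> \<le> e' * (t * c)" using nn[OF that] \<open>e' > 0\<close> by (intro mult_left_mono) auto
      finally show ?thesis .
    qed
    \<comment> \<open>The second difference is \<open>k t - k 0\<close>, so the mean value theorem
      applies in the single variable \<open>s\<close>.\<close>
    define k where "k s = h (v + t *\<^sub>R a + s *\<^sub>R b) - h (v + s *\<^sub>R b)" for s
    have hd: "((\<lambda>s. h (v + p *\<^sub>R a + s *\<^sub>R b)) has_real_derivative g (v + p *\<^sub>R a + s *\<^sub>R b) \<bullet> b) (at s)"
      if "0 \<le> p" "p \<le> t" "0 \<le> s" "s \<le> t" for p s
    proof -
      have "((\<lambda>s. v + p *\<^sub>R a + s *\<^sub>R b) has_derivative (\<lambda>s. s *\<^sub>R b)) (at s)"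
        by (auto intro!: derivative_eq_intros)
      from diff_chain_at[OF this h[OF inS[OF that]]] show ?thesis
        by (simp add: has_field_derivative_def o_def mult.commute[of _ "g _ \<bullet> b"])
    qed
    have "\<exists>\<xi>>0. \<xi> < t \<and> k t - k 0 = (t - 0) *
        (g (v + t *\<^sub>R a + \<xi> *\<^sub>R b) \<bullet> b - g (v + \<xi> *\<^sub>R b) \<bullet> b)"
    proof (rule MVT2[OF t(1)])
      fix s assume s: "0 \<le> s" "s \<le> t"
      show "(k has_real_derivative
          g (v + t *\<^sub>R a + s *\<^sub>R b) \<bullet> b - g (v + s *\<^sub>R b) \<bullet> b) (at s)"
        unfolding k_def using DERIV_diff[OF hd[of t s] hd[of 0 s]] s t by simp
    qed
    then obtain \<xi> where \<xi>: "0 < \<xi>" "\<xi> < t"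
      and k: "k t - k 0 = t * ((g (v + t *\<^sub>R a + \<xi> *\<^sub>R b) - g (v + \<xi> *\<^sub>R b)) \<bullet> b)"
      by (auto simp: inner_diff_left)
    \<comment> \<open>When \<open>g\<close> is expanded at \<open>v\<close> towards both
      intermediate points, the contributions \<open>D (\<xi> *\<^sub>R b)\<close> cancel and only
      \<open>t *\<^sub>R D a\<close> remains.\<close>
    define R where "R = g (v + t *\<^sub>R a + \<xi> *\<^sub>R b) - g (v + \<xi> *\<^sub>R b) - t *\<^sub>R D a"
    have "R = (g (v + t *\<^sub>R a + \<xi> *\<^sub>R b) - g v - D (t *\<^sub>R a + \<xi> *\<^sub>R b))
        - (g (v + 0 *\<^sub>R a + \<xi> *\<^sub>R b) - g v - D (0 *\<^sub>R a + \<xi> *\<^sub>R b))"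
      by (simp add: R_def D.add D.scaleR)
    then have "norm R \<le> e' * (t * c) + e' * (t * c)"
      using est[of t \<xi>] est[of 0 \<xi>] \<xi> t norm_triangle_ineq4 by (smt (verit) less_imp_le)
    moreover have "\<bar>R \<bullet> b\<bar> \<le> norm R * c"
      using Cauchy_Schwarz_ineq2[of R b] c by (meson mult_left_mono norm_ge_zero order_trans)
    ultimately have "\<bar>R \<bullet> b\<bar> \<le> (e' * (t * c) + e' * (t * c)) * c"
      using c by (meson mult_right_mono less_imp_le order_trans)
    also have "\<dots> = e * t" using c by (simp add: e'_def field_simps)
    finally have R: "\<bar>R \<bullet> b\<bar> \<le> e * t" .
    have "h (v + t *\<^sub>R a + t *\<^sub>R b) - h (v + t *\<^sub>R a) - h (v + t *\<^sub>R b) + h v - t\<^sup>2 * (D a \<bullet> b)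
        = (k t - k 0) - t\<^sup>2 * (D a \<bullet> b)" by (simp add: k_def)
    also have "\<dots> = t * (R \<bullet> b)"
      unfolding k by (simp add: R_def inner_diff_left power2_eq_square algebra_simps)
    also have "\<bar>\<dots>\<bar> \<le> t * (e * t)" using R t by (simp add: abs_mult)
    finally show ?thesis by (simp add: power2_eq_square mult.left_commute)
  qed
  ultimately show ?thesis by blast
qed

text \<open>Swapping \<open>a\<close> and \<open>b\<close> leaves the second difference unchanged,
  so the two values differ by at most \<open>2 * e\<close>; this is contradictory when
  \<open>e\<close> is a third of an assumed gap.\<close>

lemma symmetric_second_derivative:
  fixes h :: "'a::real_inner \<Rightarrow> real"
  assumes "open S" "v \<in> S"
    and "\<And>w. w \<in> S \<Longrightarrow> (h has_derivative (\<lambda>d. g w \<bullet> d)) (at w)"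
    and "(g has_derivative D) (at v)"
  shows "D a \<bullet> b = D b \<bullet> a"
proof (rule ccontr)
  assume ne: "D a \<bullet> b \<noteq> D b \<bullet> a"
  define e where "e = \<bar>D a \<bullet> b - D b \<bullet> a\<bar> / 3"
  have e: "e > 0" using ne by (simp add: e_def)
  obtain d1 d2 where d: "d1 > 0" "d2 > 0"
    and 1: "\<And>t. 0 < t \<and> t < d1 \<Longrightarrow> \<bar>h (v + t *\<^sub>R a + t *\<^sub>R b) - h (v + t *\<^sub>R a) - h (v + t *\<^sub>R b) + h v - t\<^sup>2 * (D a \<bullet> b)\<bar> \<le> e * t\<^sup>2"
    and 2: "\<And>t. 0 < t \<and> t < d2 \<Longrightarrow> \<bar>h (v + t *\<^sub>R b + t *\<^sub>R a) - h (v + t *\<^sub>R b) - h (v + t *\<^sub>R a) + h v - t\<^sup>2 * (D b \<bullet> a)\<bar> \<le> e * t\<^sup>2"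
    using second_difference_bound[OF assms e, of a b] second_difference_bound[OF assms e, of b a] by auto
  define t where "t = min d1 d2 / 2"
  have t: "0 < t" "t < d1" "t < d2" using d by (auto simp: t_def)
  have eq: "v + t *\<^sub>R b + t *\<^sub>R a = v + t *\<^sub>R a + t *\<^sub>R b" by simp
  have "\<bar>t\<^sup>2 * (D a \<bullet> b) - t\<^sup>2 * (D b \<bullet> a)\<bar> \<le> 2 * (e * t\<^sup>2)"
    using 1[OF conjI[OF t(1,2)]] 2[OF conjI[OF t(1,3)]] unfolding eq by linarith
  then have "t\<^sup>2 * \<bar>D a \<bullet> b - D b \<bullet> a\<bar> \<le> t\<^sup>2 * (2 * e)"
    by (simp add: abs_mult flip: right_diff_distrib) (simp add: mult.commute)
  then have "\<bar>D a \<bullet> b - D b \<bullet> a\<bar> \<le> 2 * e" using t by simp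
  then show False using e by (simp add: e_def)
qed

text \<open>Cramer's rule: the solution is a quotient of determinants, which are polynomials in
  continuous entries. It serves for a derivative that is known only through a linear
  equation.\<close>

lemma continuous_on_linear_solution:
  fixes L :: "'a::topological_space \<Rightarrow> real^'n \<Rightarrow> real^'n"
  assumes lin: "\<And>t. t \<in> T \<Longrightarrow> linear (L t)"
    and inj: "\<And>t. t \<in> T \<Longrightarrow> inj (L t)"
    and L: "\<And>w. continuous_on T (\<lambda>t. L t w)"
    and b: "continuous_on T b"
    and s: "\<And>t. t \<in> T \<Longrightarrow> L t (s t) = b t"
  shows "continuous_on T s"
proof -
  define A where "A t = matrix (L t)" for t
  have A: "A t *v w = L t w" if "t \<in> T" for t w
    unfolding A_def by (rule matrix_works) (use lin[OF that] in \<open>simp add: linear_matrix_vector_mul_eq\<close>)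
  have d: "det (A t) \<noteq> 0" if "t \<in> T" for t
    using inj[OF that] lin[OF that] A_def det_nz_iff_inj by metis
  have cA: "continuous_on T (\<lambda>t. A t $ i $ j)" for i j
    unfolding A_def matrix_def by (simp add: continuous_on_component[OF L])
  have cdet: "continuous_on T (\<lambda>t. det (B t))"
    if "\<And>i j. continuous_on T (\<lambda>t. B t $ i $ j)" for B :: "'a \<Rightarrow> real^'n^'n"
    unfolding det_def by (intro continuous_intros that)
  have "s t = (\<chi> k. det (\<chi> i j. if j = k then b t $ i else A t $ i $ j) / det (A t))" if "t \<in> T" for t
    using cramer[OF d[OF that], of "s t" "b t"] A[OF that] s[OF that] by simp
  moreover have "continuous_on T (\<lambda>t. (\<chi> k. det (\<chi> i j. if j = k then b t $ i else A t $ i $ j) / det (A t)))"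
  proof (intro continuous_on_vec_lambda continuous_on_divide cdet)
    show "continuous_on T (\<lambda>t. (\<chi> i j. if j = k then b t $ i else A t $ i $ j) $ i $ j)" for i j k
      by (cases "j = k") (simp_all add: cA continuous_on_component[OF b])
  qed (use cA d in auto)
  ultimately show ?thesis by (metis (no_types, lifting) continuous_on_eq)
qed

text \<open>The hypothesis on \<open>w\<close> says that points of \<open>S\<close> leave
  \<open>x\<close> in the direction \<open>w\<close> up to a small error. At such points the
  difference of the two derivatives is nearly \<open>t\<close> times its value at \<open>w\<close>
  and also of smaller order than \<open>t\<close>, so that value is zero.\<close>

lemma has_derivative_within_unique_tangent:
  fixes f :: "'a::real_normed_vector \<Rightarrow> 'b::real_normed_vector"
  assumes f: "(f has_derivative f') (at x within S)" "(f has_derivative f'') (at x within S)"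
    and w: "\<And>e. e > 0 \<Longrightarrow> \<exists>t y. 0 < t \<and> t < e \<and> y \<in> S \<and> norm (y - x - t *\<^sub>R w) \<le> e * t"
  shows "f' w = f'' w"
proof (rule ccontr)
  assume ne: "f' w \<noteq> f'' w"
  define D where "D z = f' z - f'' z" for z
  interpret D: bounded_linear D
    unfolding D_def by (intro bounded_linear_sub has_derivative_bounded_linear[OF f(1)]
        has_derivative_bounded_linear[OF f(2)])
  obtain B where B: "B > 0" "\<And>z. norm (D z) \<le> norm z * B" using D.pos_bounded by blast
  define q where "q = norm (D w)"
  have q: "q > 0" using ne by (simp add: q_def D_def)
  have "((\<lambda>y. 0) has_derivative D) (at x within S)"
    using has_derivative_diff[OF f] by (simp add: D_def[abs_def])
  then have "\<forall>e>0. \<exists>d>0. \<forall>y\<in>S. norm (y - x) < d \<longrightarrow> norm (D (y - x)) \<le> e * norm (y - x)"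
    by (simp add: has_derivative_within_alt)
  moreover define c where "c = q / (2 * (norm w + 1))"
  have c: "c > 0" using q by (simp add: c_def add_nonneg_pos)
  ultimately obtain d where d: "d > 0"
    and dd: "\<And>y. y \<in> S \<Longrightarrow> norm (y - x) < d \<Longrightarrow> norm (D (y - x)) \<le> c * norm (y - x)" by blast
  \<comment> \<open>The three bounds make the remainder at most \<open>t\<close>, keep
    \<open>y\<close> within distance \<open>d\<close> of \<open>x\<close>, and make \<open>D\<close>
    of the remainder at most \<open>t * q / 4\<close>. Together with the error
    \<open>t * q / 2\<close> that comes from \<open>c\<close>, the total stays below
    \<open>t * q\<close>.\<close>
  define e where "e = min (min 1 (d / (norm w + 1))) (q / (4 * B))"
  have e: "e > 0" using d q B by (simp add: e_def add_nonneg_pos)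
  obtain t y where t: "0 < t" "t < e" "y \<in> S" and y: "norm (y - x - t *\<^sub>R w) \<le> e * t"
    using w[OF e] by blast
  define r where "r = y - x - t *\<^sub>R w"
  have yx: "y - x = t *\<^sub>R w + r" by (simp add: r_def)
  have r: "norm r \<le> e * t" using y by (simp add: r_def)
  have "e * t \<le> 1 * t" using t by (intro mult_right_mono) (auto simp: e_def)
  then have "norm r \<le> t" using r by simp
  then have n: "norm (y - x) \<le> t * (norm w + 1)"
    unfolding yx using norm_triangle_ineq[of "t *\<^sub>R w" r] t by (simp add: algebra_simps)
  also have "\<dots> < d"
  proof -
    have "t < d / (norm w + 1)" using t by (simp add: e_def)
    moreover have "0 < norm w + 1" by (simp add: add_nonneg_pos)
    ultimately show ?thesis by (simp add: pos_less_divide_eq)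
  qed
  finally have "norm (D (y - x)) \<le> c * norm (y - x)" using dd t by blast
  also have "\<dots> \<le> c * (t * (norm w + 1))" using n c by (intro mult_left_mono) auto
  also have "\<dots> = t * q / 2"
    using add_nonneg_pos[of "norm w" 1] by (simp add: c_def field_simps)
  finally have 1: "norm (t *\<^sub>R D w + D r) \<le> t * q / 2" unfolding yx by (simp add: D.add D.scaleR)
  have "norm (D r) \<le> e * t * B" using B(2)[of r] r B(1) by (meson mult_right_mono less_imp_le order_trans)
  also have "\<dots> \<le> (q / (4 * B)) * t * B"
    using t B by (intro mult_right_mono) (auto simp: e_def)
  also have "\<dots> = t * q / 4" using B by simp
  finally have 2: "norm (D r) \<le> t * q / 4" .
  have "t * q = norm ((t *\<^sub>R D w + D r) - D r)" using t by (simp add: q_def)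
  also have "\<dots> \<le> t * q / 2 + t * q / 4" using norm_triangle_ineq4[of "t *\<^sub>R D w + D r" "D r"] 1 2 by linarith
  finally show False using t q by simp
qed

section \<open>Gradients and normalized vector fields\<close>

text \<open>Linear forms are identified with vectors, so that the second derivative becomes an
  endomorphism of the space.\<close>

lemma C2_on_gradientE:
  fixes f :: "'a::euclidean_space \<Rightarrow> real"
  assumes "C2_on S f"
  obtains G A where "\<And>x. x \<in> S \<Longrightarrow> (f has_derivative (\<lambda>w. G x \<bullet> w)) (at x)"
    and "\<And>x. x \<in> S \<Longrightarrow> (G has_derivative A x) (at x)"
    and "\<And>w. continuous_on S (\<lambda>x. A x w)"
proof -
  obtain f' :: "'a \<Rightarrow> 'a \<Rightarrow>\<^sub>L real" and f'' :: "'a \<Rightarrow> 'a \<Rightarrow>\<^sub>L ('a \<Rightarrow>\<^sub>L real)" where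
    f: "\<And>x. x \<in> S \<Longrightarrow> (f has_derivative blinfun_apply (f' x)) (at x)"
      "\<And>x. x \<in> S \<Longrightarrow> (f' has_derivative blinfun_apply (f'' x)) (at x)" "continuous_on S f''"
    using assms unfolding C2_on_def by blast
  \<comment> \<open>The Riesz isomorphism; being bounded and linear, it preserves differentiability
    and continuity.\<close>
  define J :: "('a \<Rightarrow>\<^sub>L real) \<Rightarrow> 'a" where "J l = (\<Sum>b\<in>Basis. blinfun_apply l b *\<^sub>R b)" for l
  have J: "J l \<bullet> w = l w" for l w
  proof -
    have "l w = l (\<Sum>b\<in>Basis. (w \<bullet> b) *\<^sub>R b)" by (simp add: euclidean_representation)
    also have "\<dots> = J l \<bullet> w"
      by (simp add: J_def inner_sum_left blinfun.sum_right blinfun.scaleR_right inner_commute[of w] mult.commute)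
    finally show ?thesis by simp
  qed
  have bJ: "bounded_linear J"
    unfolding J_def by (intro bounded_linear_intros)
  show thesis
  proof (rule that[of "\<lambda>x. J (f' x)" "\<lambda>x w. J (f'' x w)"])
    show "(f has_derivative (\<lambda>w. J (f' x) \<bullet> w)) (at x)" if "x \<in> S" for x
      using f(1)[OF that] by (simp add: J)
    show "((\<lambda>x. J (f' x)) has_derivative (\<lambda>w. J (f'' x w))) (at x)" if "x \<in> S" for x
      by (rule bounded_linear.has_derivative[OF bJ f(2)[OF that]])
    show "continuous_on S (\<lambda>x. J (f'' x w))" for w
      by (intro bounded_linear.continuous_on[OF bJ] continuous_intros f(3))
  qed
qed

text \<open>Quotient rule: the radial part of \<open>A w\<close> only changes the length of
  \<open>G\<close>, so the projection orthogonal to \<open>sgn (G x)\<close> survives.\<close>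

lemma has_derivative_sgn:
  fixes G :: "'a::real_normed_vector \<Rightarrow> 'b::real_inner"
  assumes G: "(G has_derivative A) (at x)" and nz: "G x \<noteq> 0"
  shows "((\<lambda>y. sgn (G y)) has_derivative
    (\<lambda>w. (1 / norm (G x)) *\<^sub>R (A w - (A w \<bullet> sgn (G x)) *\<^sub>R sgn (G x)))) (at x)"
proof -
  have "((\<lambda>y. norm (G y)) has_derivative (\<lambda>w. A w \<bullet> sgn (G x))) (at x)"
    using diff_chain_at[OF G has_derivative_norm[OF nz]] by (simp add: o_def)
  from has_derivative_scaleR[OF Deriv.has_derivative_inverse[OF _ this] G] nz
  have "((\<lambda>y. inverse (norm (G y)) *\<^sub>R G y) has_derivative
     (\<lambda>w. inverse (norm (G x)) *\<^sub>R A w + (- (inverse (norm (G x)) * (A w \<bullet> sgn (G x)) * inverse (norm (G x)))) *\<^sub>R G x)) (at x)"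
    by simp
  moreover have "inverse (norm (G x)) *\<^sub>R A w + (- (inverse (norm (G x)) * (A w \<bullet> sgn (G x)) * inverse (norm (G x)))) *\<^sub>R G x
     = (1 / norm (G x)) *\<^sub>R (A w - (A w \<bullet> sgn (G x)) *\<^sub>R sgn (G x))" for w
    by (simp add: sgn_div_norm scaleR_diff_right divide_inverse mult_ac)
  ultimately show ?thesis by (simp add: sgn_div_norm)
qed

lemma has_derivative_sgn_id:
  fixes v :: "'a::real_inner"
  assumes "v \<noteq> 0"
  shows "(sgn has_derivative (\<lambda>w. (1 / norm v) *\<^sub>R (w - (w \<bullet> sgn v) *\<^sub>R sgn v))) (at v)"
  using has_derivative_sgn[OF has_derivative_ident assms] by simp

section \<open>Rays and normals of sublevel sets\<close>

lemma directional_derivative: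
  fixes \<phi> :: "'a::real_inner \<Rightarrow> real"
  assumes "(\<phi> has_derivative (\<lambda>w. G \<bullet> w)) (at y)"
  shows "((\<lambda>s. \<phi> (y + s *\<^sub>R w)) has_real_derivative G \<bullet> w) (at 0)"
proof -
  have "((\<lambda>s. y + s *\<^sub>R w) has_derivative (\<lambda>s. s *\<^sub>R w)) (at 0)"
    by (auto intro!: derivative_eq_intros)
  from diff_chain_at[OF this, of \<phi> "\<lambda>w. G \<bullet> w"] assms show ?thesis
    by (simp add: has_field_derivative_def o_def mult.commute[of _ "G \<bullet> w"])
qed

lemma eventually_ray_in_open:
  fixes y :: "'a::real_normed_vector"
  assumes "open U" "y \<in> U"
  shows "\<forall>\<^sub>F s in at_right (0::real). y + s *\<^sub>R w \<in> U"
proof -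
  have "((\<lambda>s. y + s *\<^sub>R w) \<longlongrightarrow> y + 0 *\<^sub>R w) (at_right 0)" by (intro tendsto_intros)
  then show ?thesis using topological_tendstoD[OF _ assms(1)] assms(2) by simp
qed

lemma eventually_ray_increasing:
  fixes \<phi> :: "'a::real_inner \<Rightarrow> real"
  assumes "(\<phi> has_derivative (\<lambda>w. G \<bullet> w)) (at y)" "G \<bullet> w > 0"
  shows "\<forall>\<^sub>F s in at_right 0. \<phi> (y + s *\<^sub>R w) > \<phi> y"
  using DERIV_pos_inc_right[OF directional_derivative[OF assms(1)] assms(2)]
  by (auto simp: eventually_at_right_field)

lemma eventually_ray_decreasing:
  fixes \<phi> :: "'a::real_inner \<Rightarrow> real"
  assumes "(\<phi> has_derivative (\<lambda>w. G \<bullet> w)) (at y)" "G \<bullet> w < 0"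
  shows "\<forall>\<^sub>F s in at_right 0. \<phi> (y + s *\<^sub>R w) < \<phi> y"
  using DERIV_neg_dec_right[OF directional_derivative[OF assms(1)] assms(2)]
  by (auto simp: eventually_at_right_field)

text \<open>If \<open>m\<close> differed from \<open>sgn G\<close>, a short ray along
  \<open>m - sgn G\<close> would stay in the sublevel set although the product with \<open>m\<close>
  increases strictly along it.\<close>

lemma sublevel_normal_unique:
  fixes \<phi> :: "'a::real_inner \<Rightarrow> real"
  assumes \<phi>: "(\<phi> has_derivative (\<lambda>w. G \<bullet> w)) (at y)" "G \<noteq> 0" "\<phi> y = 0"
    and U: "open U" "y \<in> U" "{z \<in> U. \<phi> z \<le> 0} \<subseteq> K"
    and m: "norm m = 1" "\<And>z. z \<in> K \<Longrightarrow> (z - y) \<bullet> m \<le> 0"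
  shows "m = sgn G"
proof (rule ccontr)
  assume ne: "m \<noteq> sgn G"
  have g: "norm (sgn G) = 1" using \<phi> by (simp add: norm_sgn)
  \<comment> \<open>Strict Cauchy-Schwarz for two different unit vectors, from the square of their
    distance.\<close>
  have "(m - sgn G) \<bullet> (m - sgn G) > 0" using ne by simp
  also have "(m - sgn G) \<bullet> (m - sgn G) = 2 - 2 * (m \<bullet> sgn G)"
    using m(1) g by (simp add: inner_diff_left inner_diff_right inner_commute[of "sgn G" m] norm_eq_1)
  finally have lt: "m \<bullet> sgn G < 1" by simp
  have "G \<bullet> (m - sgn G) = (norm G *\<^sub>R sgn G) \<bullet> (m - sgn G)"
    using \<phi>(2) by (simp add: sgn_div_norm)
  also have "\<dots> = norm G * (m \<bullet> sgn G - 1)"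
    using g by (simp only: inner_scaleR_left inner_diff_right dot_square_norm inner_commute[of m]) (simp add: right_diff_distrib)
  also have "\<dots> < 0" using lt \<phi>(2) by (simp add: mult_pos_neg)
  finally have "\<forall>\<^sub>F s in at_right 0. \<phi> (y + s *\<^sub>R (m - sgn G)) < \<phi> y"
    by (rule eventually_ray_decreasing[OF \<phi>(1)])
  then have "\<forall>\<^sub>F s in at_right (0::real). (m - sgn G) \<bullet> m \<le> 0"
    using eventually_ray_in_open[OF U(1,2), of "m - sgn G"] eventually_at_right_less[of 0]
  proof eventually_elim
    case (elim s)
    then have "y + s *\<^sub>R (m - sgn G) \<in> K" using \<phi>(3) U(3) by auto
    from m(2)[OF this] elim show ?case by (simp add: mult_le_0_iff)
  qed
  then have "(m - sgn G) \<bullet> m \<le> 0" by simp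
  then show False using lt m(1) by (simp add: inner_diff_left norm_eq_1 inner_commute[of "sgn G" m])
qed

section \<open>Second order derivatives on a strip\<close>

text \<open>Explicit total derivatives serve as common data for the C2 property and for the iterated
  partial derivatives in \<open>op_A\<close>.\<close>

lemma
  fixes f P R P1 P2 R1 R2 :: "real \<times> real \<Rightarrow> real"
  assumes f: "\<And>t q. q \<in> {m<..<M} \<Longrightarrow> (f has_derivative (\<lambda>(a, b). P (t, q) * a + R (t, q) * b)) (at (t, q))"
    and P: "\<And>t q. q \<in> {m<..<M} \<Longrightarrow> (P has_derivative (\<lambda>(a, b). P1 (t, q) * a + P2 (t, q) * b)) (at (t, q))"
    and R: "\<And>t q. q \<in> {m<..<M} \<Longrightarrow> (R has_derivative (\<lambda>(a, b). R1 (t, q) * a + R2 (t, q) * b)) (at (t, q))"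
  shows C2_on_strip: "\<lbrakk>continuous_on (UNIV \<times> {m<..<M}) P1; continuous_on (UNIV \<times> {m<..<M}) P2;
      continuous_on (UNIV \<times> {m<..<M}) R1; continuous_on (UNIV \<times> {m<..<M}) R2\<rbrakk> \<Longrightarrow> C2_on (UNIV \<times> {m<..<M}) f"
    and op_A_strip: "p \<in> {m<..<M} \<Longrightarrow> op_A (\<lambda>t q. f (t, q)) \<theta> p
      = (P1 (\<theta>, p) + f (\<theta>, p)) * R2 (\<theta>, p) - (P2 (\<theta>, p))\<^sup>2"
proof -
  let ?S = "UNIV \<times> {m<..<M} :: (real \<times> real) set"
  assume c: "continuous_on ?S P1" "continuous_on ?S P2" "continuous_on ?S R1" "continuous_on ?S R2"
  define f' :: "real \<times> real \<Rightarrow> (real \<times> real) \<Rightarrow>\<^sub>L real"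
    where "f' q = P q *\<^sub>R fst_blinfun + R q *\<^sub>R snd_blinfun" for q
  \<comment> \<open>\<open>E k l\<close> is the bilinear form that sends \<open>x\<close> and
    \<open>y\<close> to \<open>k x * l y\<close>.\<close>
  define E :: "((real \<times> real) \<Rightarrow>\<^sub>L real) \<Rightarrow> ((real \<times> real) \<Rightarrow>\<^sub>L real) \<Rightarrow> (real \<times> real) \<Rightarrow>\<^sub>L ((real \<times> real) \<Rightarrow>\<^sub>L real)"
    where "E k l = blinfun_scaleR_left l o\<^sub>L k" for k l
  define f'' where "f'' q = P1 q *\<^sub>R E fst_blinfun fst_blinfun + P2 q *\<^sub>R E snd_blinfun fst_blinfun
      + R1 q *\<^sub>R E fst_blinfun snd_blinfun + R2 q *\<^sub>R E snd_blinfun snd_blinfun" for q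
  show "C2_on ?S f"
    unfolding C2_on_def
  proof (intro exI conjI ballI)
    fix x assume "x \<in> ?S"
    then obtain t q where x: "x = (t, q)" and q: "q \<in> {m<..<M}" by auto
    have "blinfun_apply (f' x) = (\<lambda>(a, b). P (t, q) * a + R (t, q) * b)"
      by (auto simp: f'_def x blinfun.bilinear_simps)
    then show "(f has_derivative blinfun_apply (f' x)) (at x)" using f[OF q] by (simp add: x)
    have "(f' has_derivative (\<lambda>z. (case z of (a, b) \<Rightarrow> P1 (t, q) * a + P2 (t, q) * b) *\<^sub>R fst_blinfun
        + (case z of (a, b) \<Rightarrow> R1 (t, q) * a + R2 (t, q) * b) *\<^sub>R snd_blinfun)) (at x)"
      unfolding f'_def x by (intro has_derivative_add has_derivative_scaleR_left P R q)
    moreover have "blinfun_apply (f'' x) = (\<lambda>z. (case z of (a, b) \<Rightarrow> P1 (t, q) * a + P2 (t, q) * b) *\<^sub>R fst_blinfun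
        + (case z of (a, b) \<Rightarrow> R1 (t, q) * a + R2 (t, q) * b) *\<^sub>R snd_blinfun)"
      by (auto simp: f''_def E_def x blinfun.bilinear_simps scaleR_left.add algebra_simps)
    ultimately show "(f' has_derivative blinfun_apply (f'' x)) (at x)" by simp
  next
    show "continuous_on ?S f''" unfolding f''_def by (intro continuous_intros c)
  qed
next
  assume p: "p \<in> {m<..<M}"
  have fst: "((\<lambda>t. g (t, q)) has_real_derivative a) (at t)"
    if "(g has_derivative (\<lambda>(x, y). a * x + b * y)) (at (t, q))" for g :: "real \<times> real \<Rightarrow> real" and a b t q
  proof -
    have "((\<lambda>t. (t, q)) has_derivative (\<lambda>x. (x, 0))) (at t)"
      by (intro has_derivative_Pair has_derivative_ident has_derivative_const)
    from diff_chain_at[OF this that] show ?thesis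
      by (simp add: o_def has_field_derivative_def)
  qed
  have snd: "((\<lambda>q. g (t, q)) has_real_derivative b) (at q)"
    if "(g has_derivative (\<lambda>(x, y). a * x + b * y)) (at (t, q))" for g :: "real \<times> real \<Rightarrow> real" and a b t q
  proof -
    have "((\<lambda>q. (t, q)) has_derivative (\<lambda>y. (0, y))) (at q)"
      by (intro has_derivative_Pair has_derivative_ident has_derivative_const)
    from diff_chain_at[OF this that] show ?thesis
      by (simp add: o_def has_field_derivative_def)
  qed
  have fP: "partial_fst (\<lambda>t q. f (t, q)) t q = P (t, q)" if "q \<in> {m<..<M}" for t q
    unfolding partial_fst_def by (rule DERIV_imp_deriv[OF fst[OF f[OF that]]])
  have fR: "partial_snd (\<lambda>t q. f (t, q)) t q = R (t, q)" if "q \<in> {m<..<M}" for t q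
    unfolding partial_snd_def by (rule DERIV_imp_deriv[OF snd[OF f[OF that]]])
  \<comment> \<open>\<open>fP\<close> and \<open>fR\<close> hold only on the open interval, so
    derivatives in \<open>q\<close> are compared on a neighbourhood of \<open>p\<close>; in the
    first variable the formulas hold for all \<open>t\<close> at once and rewriting
    suffices.\<close>
  have ev: "\<forall>\<^sub>F q in nhds p. q \<in> {m<..<M}" by (rule eventually_nhds_in_open[OF _ p]) simp
  have "partial_fst (partial_fst (\<lambda>t q. f (t, q))) \<theta> p = P1 (\<theta>, p)"
    unfolding partial_fst_def[of "partial_fst _"] fP[OF p] by (rule DERIV_imp_deriv[OF fst[OF P[OF p]]])
  moreover have "partial_snd (partial_fst (\<lambda>t q. f (t, q))) \<theta> p = P2 (\<theta>, p)"
  proof -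
    have "\<forall>\<^sub>F q in nhds p. partial_fst (\<lambda>t q. f (t, q)) \<theta> q = P (\<theta>, q)"
      using ev by eventually_elim (rule fP)
    from deriv_cong_ev[OF this refl] show ?thesis
      unfolding partial_snd_def[of "partial_fst _"] using DERIV_imp_deriv[OF snd[OF P[OF p]]] by simp
  qed
  moreover have "partial_snd (partial_snd (\<lambda>t q. f (t, q))) \<theta> p = R2 (\<theta>, p)"
  proof -
    have "\<forall>\<^sub>F q in nhds p. partial_snd (\<lambda>t q. f (t, q)) \<theta> q = R (\<theta>, q)"
      using ev by eventually_elim (rule fR)
    from deriv_cong_ev[OF this refl] show ?thesis
      unfolding partial_snd_def[of "partial_snd _"] using DERIV_imp_deriv[OF snd[OF R[OF p]]] by simp
  qed
  ultimately show "op_A (\<lambda>t q. f (t, q)) \<theta> p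
      = (P1 (\<theta>, p) + f (\<theta>, p)) * R2 (\<theta>, p) - (P2 (\<theta>, p))\<^sup>2"
    by (simp add: op_A_def)
qed

subsection \<open>Support points\<close>

text \<open>Up to scaling, the inverse of the Gauss map. Strict convexity makes the maximizer unique
  for \<open>v \<noteq> 0\<close>; for \<open>v = 0\<close> every point of \<open>K\<close> is a
  maximizer, which is why zero is excluded below.\<close>

definition support_point :: "(real^3) set \<Rightarrow> real^3 \<Rightarrow> real^3" where
  "support_point K v = (THE x. x \<in> K \<and> (\<forall>y\<in>K. y \<bullet> v \<le> x \<bullet> v))"

locale strict_convex_body =
  fixes K :: "(real^3) set"
  assumes strictly_convex: "strictly_convex_body K"
begin

lemma compact: "compact K" and convex: "convex K" and interior_nonempty: "interior K \<noteq> {}"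
  and closed: "closed K"
  using strictly_convex by (auto simp: strictly_convex_body_def compact_imp_closed)

lemma nonempty: "K \<noteq> {}"
  using interior_nonempty interior_subset by blast

lemma frontier_subset: "frontier K \<subseteq> K"
  by (simp add: closed frontier_subset_closed)

lemma interior_not_maximal:
  assumes "z \<in> interior K" "v \<noteq> 0"
  shows "\<exists>y\<in>K. z \<bullet> v < y \<bullet> v"
proof -
  have "\<forall>\<^sub>F s in at_right (0::real). z \<bullet> v < (z + s *\<^sub>R v) \<bullet> v \<and> z + s *\<^sub>R v \<in> interior K"
    using eventually_ray_in_open[OF open_interior assms(1), of v] eventually_at_right_less[of 0]
    by eventually_elim (use assms in \<open>simp add: inner_add_left\<close>)
  then obtain s where "z \<bullet> v < (z + s *\<^sub>R v) \<bullet> v" "z + s *\<^sub>R v \<in> interior K"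
    using eventually_happens trivial_limit_at_right_real by blast
  then show ?thesis using interior_subset by blast
qed

text \<open>The midpoint of two maximizers would be an interior point with the same maximal
  value.\<close>

lemma maximizer_unique:
  assumes "x \<in> K" "\<And>y. y \<in> K \<Longrightarrow> y \<bullet> v \<le> x \<bullet> v"
    and "x' \<in> K" "\<And>y. y \<in> K \<Longrightarrow> y \<bullet> v \<le> x' \<bullet> v" and "v \<noteq> 0"
  shows "x = x'"
proof (rule ccontr)
  assume "x \<noteq> x'"
  then have "midpoint x x' \<in> interior K"
    using strictly_convex assms(1,3) unfolding strictly_convex_body_def
    by (meson midpoint_in_open_segment subset_eq)
  from interior_not_maximal[OF this assms(5)] obtain y where y: "y \<in> K" "midpoint x x' \<bullet> v < y \<bullet> v" by blast
  have "x \<bullet> v = x' \<bullet> v" using assms by (meson order_antisym)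
  then have "midpoint x x' \<bullet> v = x \<bullet> v" by (simp add: midpoint_def inner_add_left)
  then show False using assms(2)[OF y(1)] y(2) by simp
qed

lemma support_point_ex1:
  assumes "v \<noteq> 0"
  shows "\<exists>!x. x \<in> K \<and> (\<forall>y\<in>K. y \<bullet> v \<le> x \<bullet> v)"
proof -
  obtain x where "x \<in> K" "\<forall>y\<in>K. y \<bullet> v \<le> x \<bullet> v"
    using continuous_attains_sup[OF compact nonempty continuous_on_inner[OF continuous_on_id continuous_on_const]] by blast
  then show ?thesis using maximizer_unique[OF _ _ _ _ assms] by blast
qed

lemma
  assumes "v \<noteq> 0"
  shows support_point_in: "support_point K v \<in> K"
    and support_point_max: "y \<in> K \<Longrightarrow> y \<bullet> v \<le> support_point K v \<bullet> v"
  using theI'[OF support_point_ex1[OF assms]] by (auto simp: support_point_def)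

lemma support_point_eqI:
  assumes "v \<noteq> 0" "x \<in> K" "\<And>y. y \<in> K \<Longrightarrow> y \<bullet> v \<le> x \<bullet> v"
  shows "support_point K v = x"
  using maximizer_unique[OF support_point_in[OF assms(1)] support_point_max[OF assms(1)] assms(2,3,1)] .

lemma support_point_frontier:
  assumes "v \<noteq> 0"
  shows "support_point K v \<in> frontier K"
proof -
  have "support_point K v \<notin> interior K"
    using interior_not_maximal[OF _ assms] support_point_max[OF assms] by force
  then show ?thesis
    using support_point_in[OF assms] closure_subset by (auto simp: frontier_def)
qed

lemma support_fun_eq:
  assumes "v \<noteq> 0"
  shows "support_fun K v = support_point K v \<bullet> v"
  unfolding support_fun_def
  using support_point_in[OF assms] support_point_max[OF assms] by (intro cSup_eq_maximum) auto

lemma support_point_scaleR: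
  assumes "v \<noteq> 0" "c > 0"
  shows "support_point K (c *\<^sub>R v) = support_point K v"
  using assms support_point_in[OF assms(1)] support_point_max[OF assms(1)]
  by (intro support_point_eqI) auto

text \<open>The graph is cut out by closed conditions and the values lie in the compact set
  \<open>K\<close>, so the closed graph theorem applies.\<close>

lemma continuous_on_support_point: "continuous_on (- {0}) (support_point K)"
proof -
  have sub: "support_point K \<in> - {0} \<rightarrow> K" using support_point_in by auto
  have "(\<lambda>v. (v, support_point K v)) ` (- {0})
      = ((- {0}) \<times> K) \<inter> (\<Inter>y\<in>K. {p. y \<bullet> fst p \<le> snd p \<bullet> fst p})"
    (is "?L = ?R")
  proof (rule set_eqI)
    fix p :: "(real^3) \<times> (real^3)"
    obtain v x where p: "p = (v, x)" by force
    show "p \<in> ?L \<longleftrightarrow> p \<in> ?R"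
    proof
      assume "p \<in> ?L"
      then have "v \<noteq> 0" "x = support_point K v" by (simp_all add: p image_iff)
      then show "p \<in> ?R" using support_point_in support_point_max by (simp add: p)
    next
      assume "p \<in> ?R"
      then have "v \<noteq> 0" "x \<in> K" "\<And>y. y \<in> K \<Longrightarrow> y \<bullet> v \<le> x \<bullet> v" by (simp_all add: p)
      then show "p \<in> ?L" using support_point_eqI[of v x] by (simp add: p image_iff)
    qed
  qed
  moreover have "closed (\<Inter>y\<in>K. {p. y \<bullet> fst p \<le> (snd p :: real^3) \<bullet> fst p})"
    by (intro closed_INT ballI closed_Collect_le continuous_intros)
  ultimately have "closedin (top_of_set ((- {0}) \<times> K)) ((\<lambda>v. (v, support_point K v)) ` (- {0}))"
    by (simp add: closedin_closed_Int)
  then show ?thesis using continuous_closed_graph_eq[OF compact sub] by blast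
qed

text \<open>Maximality at \<open>v\<close> and at \<open>w\<close> traps the linearization error
  between zero and \<open>norm (w - v)\<close> times the displacement of the support point, which
  tends to zero by continuity.\<close>

lemma has_derivative_support_fun:
  assumes v: "v \<noteq> 0"
  shows "(support_fun K has_derivative (\<lambda>d. support_point K v \<bullet> d)) (at v)"
  unfolding has_derivative_at_alt
proof (intro conjI allI impI)
  show "bounded_linear ((\<bullet>) (support_point K v))" by (rule bounded_linear_inner_right)
next
  fix e :: real assume e: "e > 0"
  have "isCont (support_point K) v"
    using continuous_on_support_point v by (simp add: continuous_on_eq_continuous_at open_Compl)
  then obtain d where d: "d > 0"
    "\<And>w. dist w v < d \<Longrightarrow> dist (support_point K w) (support_point K v) < e"
    using e unfolding continuous_at_eps_delta by blast
  \<comment> \<open>The bound \<open>norm v\<close> keeps \<open>w\<close> away from zero.\<close>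
  have "norm (support_fun K w - support_fun K v - support_point K v \<bullet> (w - v)) \<le> e * norm (w - v)"
    if "norm (w - v) < min d (norm v)" for w
  proof -
    have w: "w \<noteq> 0" using that by auto
    let ?r = "support_fun K w - support_fun K v - support_point K v \<bullet> (w - v)"
    have "0 \<le> ?r"
      using support_point_max[OF w support_point_in[OF v]]
      by (simp add: support_fun_eq v w inner_diff_right)
    moreover have "?r \<le> (support_point K w - support_point K v) \<bullet> (w - v)"
      using support_point_max[OF v support_point_in[OF w]]
      by (simp add: support_fun_eq v w inner_diff_right inner_diff_left)
    moreover have "\<dots> \<le> norm (support_point K w - support_point K v) * norm (w - v)"
      by (rule norm_cauchy_schwarz)
    moreover have "\<dots> \<le> e * norm (w - v)"
      using d(2)[of w] that by (intro mult_right_mono) (auto simp: dist_norm)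
    ultimately show ?thesis by simp
  qed
  then show "\<exists>d>0. \<forall>w. norm (w - v) < d \<longrightarrow>
      norm (support_fun K w - support_fun K v - support_point K v \<bullet> (w - v)) \<le> e * norm (w - v)"
    using d(1) v by (intro exI[of _ "min d (norm v)"]) auto
qed

lemma support_point_monotone:
  assumes "v \<noteq> 0" "w \<noteq> 0"
  shows "0 \<le> (support_point K w - support_point K v) \<bullet> (w - v)"
  using support_point_max[OF assms(1) support_point_in[OF assms(2)]]
    support_point_max[OF assms(2) support_point_in[OF assms(1)]]
  by (simp add: inner_diff_left inner_diff_right)

lemma frontier_normal_ex:
  assumes "x \<in> frontier K"
  shows "\<exists>n. norm n = 1 \<and> (\<forall>y\<in>K. (y - x) \<bullet> n \<le> 0)"
proof -
  have "x \<in> K" "x \<notin> rel_interior K"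
    using assms frontier_subset rel_interior_nonempty_interior[OF interior_nonempty] by (auto simp: frontier_def)
  then obtain a where a: "a \<noteq> 0" "\<And>y. y \<in> K \<Longrightarrow> a \<bullet> x \<le> a \<bullet> y"
    using supporting_hyperplane_rel_boundary[OF convex] by metis
  \<comment> \<open>The supporting hyperplane comes with an inward normal \<open>a\<close>, hence
    the sign.\<close>
  have "norm (- sgn a) = 1" using a by (simp add: norm_sgn)
  moreover have "(y - x) \<bullet> (- sgn a) \<le> 0" if "y \<in> K" for y
    using a(2)[OF that] by (simp add: sgn_div_norm inner_diff_right inner_commute[of "y - x"])
  ultimately show ?thesis by blast
qed

end

subsection \<open>Charts of the boundary\<close>

locale boundary_chart = strict_convex_body +
  fixes U :: "(real^3) set" and \<phi> :: "real^3 \<Rightarrow> real"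
    and G :: "real^3 \<Rightarrow> real^3" and A :: "real^3 \<Rightarrow> real^3 \<Rightarrow> real^3"
  assumes open_chart: "open U"
    and gradient: "\<And>y. y \<in> U \<Longrightarrow> (\<phi> has_derivative (\<lambda>w. G y \<bullet> w)) (at y)"
    and hessian: "\<And>y. y \<in> U \<Longrightarrow> (G has_derivative A y) (at y)"
    and continuous_hessian: "\<And>w. continuous_on U (\<lambda>y. A y w)"
    and regular: "\<And>y. y \<in> U \<Longrightarrow> G y \<noteq> 0"
    and sublevel: "K \<inter> U = {y \<in> U. \<phi> y \<le> 0}"
begin

lemma mem_iff: "y \<in> U \<Longrightarrow> y \<in> K \<longleftrightarrow> \<phi> y \<le> 0"
  using sublevel by blast

text \<open>The derivative of the unit normal field of the level sets; on tangent vectors at the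
  frontier it turns out to be the differential of the Gauss map.\<close>

definition normal_deriv :: "real^3 \<Rightarrow> real^3 \<Rightarrow> real^3" where
  "normal_deriv y w = (1 / norm (G y)) *\<^sub>R (A y w - (A y w \<bullet> sgn (G y)) *\<^sub>R sgn (G y))"

lemma has_derivative_normal:
  assumes "y \<in> U"
  shows "((\<lambda>z. sgn (G z)) has_derivative normal_deriv y) (at y)"
  using has_derivative_sgn[OF hessian regular, OF assms assms] unfolding normal_deriv_def[abs_def] .

lemma linear_normal_deriv: "y \<in> U \<Longrightarrow> linear (normal_deriv y)"
  using has_derivative_linear has_derivative_normal by blast

lemma norm_normal: "y \<in> U \<Longrightarrow> norm (sgn (G y)) = 1"
  by (simp add: norm_sgn regular)

lemma normal_deriv_tangent: "y \<in> U \<Longrightarrow> normal_deriv y w \<bullet> sgn (G y) = 0"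
  using norm_normal by (simp add: normal_deriv_def inner_diff_left dot_square_norm)

lemma continuous_on_gradient: "continuous_on U G"
  by (rule has_derivative_continuous_on[OF has_derivative_at_withinI[OF hessian]])

lemma continuous_on_normal_deriv: "continuous_on U (\<lambda>y. normal_deriv y w)"
  unfolding normal_deriv_def sgn_div_norm
  by (intro continuous_intros continuous_on_gradient continuous_hessian) (use regular in auto)

section \<open>Frontier and Gauss map in a chart\<close>

text \<open>Where \<open>\<phi>\<close> is negative it stays so nearby, which makes the point
  interior; where it vanishes, moving along the gradient leaves \<open>K\<close>.\<close>

lemma frontier_iff:
  assumes y: "y \<in> U"
  shows "y \<in> frontier K \<longleftrightarrow> \<phi> y = 0"
proof
  assume f: "y \<in> frontier K"
  then have "\<phi> y \<le> 0" using frontier_subset mem_iff[OF y] by blast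
  moreover have "\<not> \<phi> y < 0"
  proof
    assume "\<phi> y < 0"
    moreover have "isCont \<phi> y" using gradient[OF y] has_derivative_continuous by blast
    ultimately have "\<forall>\<^sub>F z in nhds y. \<phi> z < 0"
      using order_tendstoD(2)[of \<phi> "\<phi> y" "nhds y" 0] by (simp add: isCont_def tendsto_at_iff_tendsto_nhds)
    moreover have "\<forall>\<^sub>F z in nhds y. z \<in> U" by (rule eventually_nhds_in_open[OF open_chart y])
    ultimately have "\<forall>\<^sub>F z in nhds y. z \<in> K"
      by eventually_elim (simp add: mem_iff)
    then obtain V where "open V" "y \<in> V" "V \<subseteq> K" unfolding eventually_nhds by blast
    then have "y \<in> interior K" by (rule interiorI)
    then show False using f by (simp add: frontier_def)
  qed
  ultimately show "\<phi> y = 0" by simp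
next
  assume 0: "\<phi> y = 0"
  have "y \<notin> interior K"
  proof
    assume i: "y \<in> interior K"
    have "G y \<bullet> G y > 0" using regular[OF y] by simp
    from eventually_ray_increasing[OF gradient[OF y] this]
    have "\<forall>\<^sub>F s in at_right (0::real). False"
      using eventually_ray_in_open[OF open_interior i, of "G y"] eventually_ray_in_open[OF open_chart y, of "G y"]
    proof eventually_elim
      case (elim s)
      then have "y + s *\<^sub>R G y \<in> K" using interior_subset by blast
      then show ?case using elim 0 mem_iff by simp
    qed
    then show False by simp
  qed
  moreover have "y \<in> K" using 0 y mem_iff by simp
  ultimately show "y \<in> frontier K" using closure_subset by (auto simp: frontier_def)
qed

lemma normal_unique:
  assumes y: "y \<in> U" "y \<in> frontier K" and "norm m = 1" "\<And>z. z \<in> K \<Longrightarrow> (z - y) \<bullet> m \<le> 0"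
  shows "m = sgn (G y)"
proof (rule sublevel_normal_unique[OF gradient[OF y(1)] regular[OF y(1)] _ open_chart y(1) _ assms(3,4)])
  show "\<phi> y = 0" using frontier_iff y by blast
  show "{z \<in> U. \<phi> z \<le> 0} \<subseteq> K" using mem_iff by blast
qed

lemma normal_outward:
  assumes y: "y \<in> U" "y \<in> frontier K" and "z \<in> K"
  shows "(z - y) \<bullet> sgn (G y) \<le> 0"
  using frontier_normal_ex[OF y(2)] normal_unique[OF y] assms(3) by metis

lemma gauss_map_eq:
  assumes "y \<in> U" "y \<in> frontier K"
  shows "gauss_map K y = sgn (G y)"
  unfolding gauss_map_def
proof (rule the_equality)
  show "norm (sgn (G y)) = 1 \<and> (\<forall>z\<in>K. (z - y) \<bullet> sgn (G y) \<le> 0)"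
    using normal_outward[OF assms] norm_normal[OF assms(1)] by blast
qed (use normal_unique[OF assms] in blast)

text \<open>By the intermediate value theorem on the segment from \<open>y + s (w - e n)\<close> to \<open>y + s (w + e n)\<close>,
  along which \<open>\<phi>\<close> changes sign.\<close>

lemma tangent_vector_approx:
  assumes y: "y \<in> U" "y \<in> frontier K" and w: "w \<bullet> G y = 0" and e: "e > 0"
  shows "\<exists>s z. 0 < s \<and> s < e \<and> z \<in> frontier K \<and> norm (z - y - s *\<^sub>R w) \<le> e * s"
proof -
  define n where "n = sgn (G y)"
  have n: "norm n = 1" "G y \<bullet> n > 0"
    using norm_normal[OF y(1)] regular[OF y(1)] by (auto simp: n_def sgn_div_norm)
  have 0: "\<phi> y = 0" using frontier_iff y by blast
  have w0: "G y \<bullet> w = 0" using w by (simp add: inner_commute)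
  have p: "G y \<bullet> (w + e *\<^sub>R n) > 0" and m: "G y \<bullet> (w + (- e) *\<^sub>R n) < 0"
    using w0 n e by (simp_all add: inner_add_right inner_diff_right)
  \<comment> \<open>The convexity of a ball keeps the whole transversal segment inside
    \<open>U\<close>.\<close>
  obtain r where r: "r > 0" "ball y r \<subseteq> U" using open_chart y(1) by (meson open_contains_ball)
  then have yb: "y \<in> ball y r" by simp
  have "\<forall>\<^sub>F s in at_right 0. s < e"
    using eventually_at_right_real[OF e] by eventually_elim simp
  with eventually_ray_increasing[OF gradient[OF y(1)] p] eventually_ray_decreasing[OF gradient[OF y(1)] m]
    eventually_ray_in_open[OF open_ball yb, of "w + e *\<^sub>R n"]
    eventually_ray_in_open[OF open_ball yb, of "w + (- e) *\<^sub>R n"] eventually_at_right_less[of 0]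
  have "\<forall>\<^sub>F s in at_right (0::real). \<exists>z. 0 < s \<and> s < e \<and> z \<in> frontier K \<and> norm (z - y - s *\<^sub>R w) \<le> e * s"
  proof (eventually_elim)
    case (elim s)
    define c where "c q = y + s *\<^sub>R (w + q *\<^sub>R n)" for q
    have cU: "c q \<in> U" if "- e \<le> q" "q \<le> e" for q
    proof -
      \<comment> \<open>The parameter of \<open>c q\<close> on the segment from
        \<open>c (- e)\<close> to \<open>c e\<close>.\<close>
      define a where "a = (q + e) / (2 * e)"
      have a: "0 \<le> a" "a \<le> 1" "q = (1 - a) * (- e) + a * e" using that e by (auto simp: a_def field_simps)
      have "c q = (1 - a) *\<^sub>R c (- e) + a *\<^sub>R c e"
        unfolding c_def a(3) by (simp add: vec_eq_iff algebra_simps)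
      moreover have "c (- e) \<in> ball y r" "c e \<in> ball y r"
        using elim r by (auto simp: c_def)
      ultimately have "c q \<in> ball y r"
        using convexD_alt[OF convex_ball _ _ a(1,2)] by metis
      then show ?thesis using r by blast
    qed
    have "\<exists>q\<ge>-e. q \<le> e \<and> \<phi> (c q) = 0"
    proof (rule IVT')
      have "continuous_on U \<phi>"
        by (rule has_derivative_continuous_on[OF has_derivative_at_withinI[OF gradient]])
      moreover have "continuous_on {-e..e} c" unfolding c_def by (intro continuous_intros)
      ultimately show "continuous_on {-e..e} (\<lambda>q. \<phi> (c q))"
        by (rule continuous_on_compose2) (use cU in auto)
      show "\<phi> (c (- e)) \<le> 0" "0 \<le> \<phi> (c e)" using elim 0 by (simp_all add: c_def)
      show "- e \<le> e" using e by simp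
    qed
    then obtain q where q: "- e \<le> q" "q \<le> e" "\<phi> (c q) = 0" by blast
    have "c q \<in> frontier K" using frontier_iff[OF cU] q by simp
    moreover have "norm (c q - y - s *\<^sub>R w) = \<bar>q\<bar> * s"
      using n elim by (simp add: c_def algebra_simps abs_mult)
    moreover have "\<bar>q\<bar> * s \<le> e * s" using q elim by (intro mult_right_mono) auto
    ultimately show ?case using elim by auto
  qed
  then show ?thesis using eventually_happens trivial_limit_at_right_real by blast
qed

text \<open>\<open>weingarten\<close> is some derivative within the frontier, pinned down on tangent
  vectors only. There any two derivatives coincide, because frontier points approximate the tangent
  directions.\<close>

lemma weingarten_eq:
  assumes y: "y \<in> U" "y \<in> frontier K" and w: "w \<bullet> sgn (G y) = 0"
  shows "weingarten K y w = normal_deriv y w"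
proof -
  have d: "(gauss_map K has_derivative normal_deriv y) (at y within frontier K)"
  proof (rule has_derivative_transform_eventually)
    show "((\<lambda>z. sgn (G z)) has_derivative normal_deriv y) (at y within frontier K)"
      by (rule has_derivative_at_withinI[OF has_derivative_normal[OF y(1)]])
    show "\<forall>\<^sub>F z in at y within frontier K. sgn (G z) = gauss_map K z"
      unfolding eventually_at_topological
      by (rule exI[of _ U]) (simp add: open_chart y(1) gauss_map_eq)
  qed (simp_all add: gauss_map_eq y)
  then have "(gauss_map K has_derivative weingarten K y) (at y within frontier K)"
    unfolding weingarten_def by (metis differentiableI frechet_derivative_works)
  moreover have "w \<bullet> G y = 0" using w regular[OF y(1)] by (simp add: sgn_div_norm)
  ultimately show ?thesis
    using has_derivative_within_unique_tangent[OF _ d tangent_vector_approx[OF y]] by blast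
qed

section \<open>Inverting the unit normal field\<close>

lemma linear_normal_deriv_plus:
  "y \<in> U \<Longrightarrow> linear (\<lambda>w. normal_deriv y w + (G y \<bullet> w) *\<^sub>R sgn (G y))"
  by (intro linear_compose_add linear_normal_deriv linear_compose_scale_right bounded_linear.linear bounded_linear_intros)

text \<open>The normal component of the kernel equation makes \<open>w\<close> tangent; what remains
  puts \<open>w\<close> into the kernel of the endomorphism \<open>T\<close>, whose determinant is
  the Gaussian curvature.\<close>

lemma inj_normal_deriv_plus:
  assumes y: "y \<in> U" "y \<in> frontier K" and curv: "gauss_curvature K y > 0"
  shows "inj (\<lambda>w. normal_deriv y w + (G y \<bullet> w) *\<^sub>R sgn (G y))"
proof -
  define n where "n = sgn (G y)"
  have n: "n \<bullet> n = 1" using norm_normal[OF y(1)] by (simp add: n_def dot_square_norm)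
  define T where "T v = normal_deriv y (v - (v \<bullet> n) *\<^sub>R n) + (v \<bullet> n) *\<^sub>R n" for v
  have "weingarten K y (v - (v \<bullet> n) *\<^sub>R n) = normal_deriv y (v - (v \<bullet> n) *\<^sub>R n)" for v
    by (rule weingarten_eq[OF y]) (use n in \<open>simp add: inner_diff_left flip: n_def\<close>)
  then have "det (matrix T) \<noteq> 0"
    using curv gauss_map_eq[OF y] by (simp add: gauss_curvature_def Let_def T_def[abs_def] n_def)
  moreover interpret N: linear "normal_deriv y" by (rule linear_normal_deriv[OF y(1)])
  have "linear T"
    unfolding T_def
    by (rule linearI) (simp_all add: N.add N.diff N.scale inner_add_left algebra_simps)
  ultimately have T: "inj T" using det_nz_iff_inj by metis
  show ?thesis
    unfolding linear_injective_0[OF linear_normal_deriv_plus[OF y(1)]]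
  proof (intro allI impI)
    fix w assume eq: "normal_deriv y w + (G y \<bullet> w) *\<^sub>R sgn (G y) = 0"
    then have "(normal_deriv y w + (G y \<bullet> w) *\<^sub>R sgn (G y)) \<bullet> n = 0" by simp
    then have "G y \<bullet> w = 0" using n normal_deriv_tangent[OF y(1)] by (simp add: inner_add_left flip: n_def)
    then have "w \<bullet> n = 0" "normal_deriv y w = 0"
      using eq by (simp_all add: n_def sgn_div_norm inner_commute)
    then have "T w = T 0" by (simp add: T_def N.zero)
    then show "w = 0" using T by (simp add: inj_eq)
  qed
qed

lemma support_point_sgn: "v \<noteq> 0 \<Longrightarrow> support_point K (sgn v) = support_point K v"
  by (simp add: sgn_div_norm support_point_scaleR)

text \<open>The support point admits the outward normal \<open>sgn v\<close>, and in the chart the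
  unit normal is unique.\<close>

lemma normal_support_point:
  assumes v: "v \<noteq> 0" "support_point K v \<in> U"
  shows "sgn (G (support_point K v)) = sgn v"
proof -
  have "(z - support_point K v) \<bullet> sgn v \<le> 0" if "z \<in> K" for z
    using support_point_max[of "sgn v" z] that v by (simp add: inner_diff_left sgn_zero_iff support_point_sgn)
  then show ?thesis
    using normal_unique[OF v(2) support_point_frontier[OF v(1)], of "sgn v"] v by (simp add: norm_sgn)
qed

lemma support_point_normal:
  assumes y: "y \<in> U" "y \<in> frontier K"
  shows "support_point K (sgn (G y)) = y"
  using normal_outward[OF y] frontier_subset y regular[OF y(1)]
  by (intro support_point_eqI) (auto simp: inner_diff_left sgn_zero_iff)

text \<open>\<open>support_point\<close> inverts \<open>(1 + \<phi>) n\<close> on the frontier, where \<open>\<phi> = 0\<close>; unlike the unit normal \<open>n\<close>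
  itself, that map has an invertible derivative.\<close>

lemma has_derivative_support_point_chart:
  assumes v: "v \<noteq> 0" and x: "x = support_point K v" "x \<in> U" and curv: "gauss_curvature K x > 0"
  obtains D where "(support_point K has_derivative D) (at v)"
    and "\<And>w. normal_deriv x (D w) + (G x \<bullet> D w) *\<^sub>R sgn (G x) = (1 / norm v) *\<^sub>R (w - (w \<bullet> sgn v) *\<^sub>R sgn v)"
proof -
  define \<Psi> where "\<Psi> y = (1 + \<phi> y) *\<^sub>R sgn (G y)" for y
  define \<Psi>' where "\<Psi>' w = normal_deriv x w + (G x \<bullet> w) *\<^sub>R sgn (G x)" for w
  define S where "S = frontier K \<inter> U"
  have xS: "x \<in> S" "x \<in> frontier K" using x support_point_frontier[OF v] by (auto simp: S_def)
  have \<Psi>S: "\<Psi> y = sgn (G y)" if "y \<in> S" for y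
    using that frontier_iff[of y] by (simp add: \<Psi>_def S_def)
  have \<Psi>x: "\<Psi> x = sgn v" using \<Psi>S xS normal_support_point v x by simp
  have "linear \<Psi>'" "inj \<Psi>'"
    using linear_normal_deriv_plus[OF x(2)] inj_normal_deriv_plus[OF x(2) xS(2) curv]
    by (simp_all add: \<Psi>'_def[abs_def])
  then obtain g where g: "linear g" "g \<circ> \<Psi>' = id" using linear_injective_left_inverse by blast
  then have g2: "\<Psi>' \<circ> g = id" using linear_inverse_left \<open>linear \<Psi>'\<close> by blast
  have d\<Psi>: "(\<Psi> has_derivative \<Psi>') (at x within S)"
  proof (rule has_derivative_at_withinI)
    have "((\<lambda>y. 1 + \<phi> y) has_derivative (\<lambda>w. G x \<bullet> w)) (at x)"
      using has_derivative_add[OF has_derivative_const gradient[OF x(2)]] by simp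
    from has_derivative_scaleR[OF this has_derivative_normal[OF x(2)]]
    show "(\<Psi> has_derivative \<Psi>') (at x)"
      using frontier_iff x xS by (simp add: \<Psi>_def[abs_def] \<Psi>'_def[abs_def])
  qed
  \<comment> \<open>On \<open>S\<close> the support point inverts \<open>\<Psi>\<close>, so the
    derivative of the inverse exists within the image, a piece of the unit sphere.\<close>
  have "(support_point K has_derivative g) (at (\<Psi> x) within \<Psi> ` S)"
  proof (rule has_derivative_inverse_within[OF d\<Psi> _ xS(1) g])
    show "support_point K (\<Psi> y) = y" if "y \<in> S" for y
      using that \<Psi>S support_point_normal by (simp add: S_def)
    have "isCont (support_point K) (\<Psi> x)"
      using continuous_on_support_point v
      by (simp add: continuous_on_eq_continuous_at open_Compl \<Psi>x sgn_zero_iff)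
    then show "continuous (at (\<Psi> x) within \<Psi> ` S) (support_point K)"
      by (rule continuous_at_imp_continuous_at_within)
  qed
  \<comment> \<open>The directions whose support points stay in the chart.\<close>
  moreover define V where "V = {w \<in> - {0}. support_point K w \<in> U}"
  have V: "open V" "v \<in> V"
    using continuous_open_preimage[OF continuous_on_support_point _ open_chart] v x
    by (auto simp: V_def open_Compl vimage_def Int_def)
  have "sgn ` V \<subseteq> \<Psi> ` S"
  proof
    fix z assume "z \<in> sgn ` V"
    then obtain w where w: "w \<noteq> 0" "support_point K w \<in> U" "z = sgn w" by (auto simp: V_def)
    then have "support_point K w \<in> S" by (simp add: S_def support_point_frontier)
    moreover have "\<Psi> (support_point K w) = z" using \<Psi>S[OF calculation] w normal_support_point by simp
    ultimately show "z \<in> \<Psi> ` S" by blast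
  qed
  ultimately have "(support_point K has_derivative g) (at (sgn v) within sgn ` V)"
    unfolding \<Psi>x using has_derivative_subset by blast
  \<comment> \<open>A support point depends only on the normalized direction, so composition with
    \<open>sgn\<close> turns the derivative within the sphere into one on the open set
    \<open>V\<close>.\<close>
  from diff_chain_within[OF has_derivative_at_withinI[OF has_derivative_sgn_id[OF v]] this]
  have "(support_point K \<circ> sgn has_derivative
      g \<circ> (\<lambda>w. (1 / norm v) *\<^sub>R (w - (w \<bullet> sgn v) *\<^sub>R sgn v))) (at v)"
    using at_within_open[OF V(2,1)] by simp
  then have "(support_point K has_derivative
      (\<lambda>w. g ((1 / norm v) *\<^sub>R (w - (w \<bullet> sgn v) *\<^sub>R sgn v)))) (at v)"
    unfolding o_def
    by (rule has_derivative_transform_within_open[OF _ V]) (simp add: V_def support_point_sgn)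
  then show thesis
    by (rule that) (use g2 in \<open>simp add: fun_eq_iff \<Psi>'_def\<close>)
qed

end

subsection \<open>The Hessian of the support function\<close>

text \<open>The support point is the gradient of the support function, so this is the Hessian of the
  support function, as an endomorphism.\<close>

definition support_hessian :: "(real^3) set \<Rightarrow> real^3 \<Rightarrow> real^3 \<Rightarrow> real^3" where
  "support_hessian K v = frechet_derivative (support_point K) (at v)"

locale C2_convex_body = strict_convex_body +
  assumes C2: "C2_boundary K"
    and curvature_pos: "\<And>y. y \<in> frontier K \<Longrightarrow> gauss_curvature K y > 0"
begin

lemma boundary_chart_ex:
  assumes "x \<in> frontier K"
  shows "\<exists>U \<phi> G A. x \<in> U \<and> boundary_chart K U \<phi> G A"
proof -
  obtain U \<phi> where U: "open U" "x \<in> U" "C2_on U \<phi>"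
    "\<And>y. y \<in> U \<Longrightarrow> \<not> (\<phi> has_derivative (\<lambda>_. 0)) (at y)" "K \<inter> U = {y \<in> U. \<phi> y \<le> 0}"
    using C2 assms unfolding C2_boundary_def by meson
  obtain G A where GA: "\<And>x. x \<in> U \<Longrightarrow> (\<phi> has_derivative (\<lambda>w. G x \<bullet> w)) (at x)"
    "\<And>x. x \<in> U \<Longrightarrow> (G has_derivative A x) (at x)" "\<And>w. continuous_on U (\<lambda>x. A x w)"
    using C2_on_gradientE[OF U(3)] by blast
  have "G y \<noteq> 0" if "y \<in> U" for y
  proof
    assume "G y = 0"
    then show False using GA(1)[OF that] U(4)[OF that] by simp
  qed
  then have "boundary_chart K U \<phi> G A"
    using U(1,5) GA strict_convex_body_axioms
    by (simp only: boundary_chart_def boundary_chart_axioms_def) blast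
  then show ?thesis using U(2) by blast
qed

lemma support_hessian_works:
  assumes v: "v \<noteq> 0"
  shows "(support_point K has_derivative support_hessian K v) (at v)"
proof -
  obtain U \<phi> G A where x: "support_point K v \<in> U" and "boundary_chart K U \<phi> G A"
    using boundary_chart_ex[OF support_point_frontier[OF v]] by blast
  then interpret boundary_chart K U \<phi> G A by simp
  show ?thesis
    using has_derivative_support_point_chart[OF v refl x curvature_pos[OF support_point_frontier[OF v]]]
    unfolding support_hessian_def by (metis differentiableI frechet_derivative_works)
qed

lemma linear_support_hessian: "v \<noteq> 0 \<Longrightarrow> linear (support_hessian K v)"
  using has_derivative_linear support_hessian_works by blast

lemma support_hessian_chart:
  assumes "boundary_chart K U \<phi> G A" and v: "v \<noteq> 0" and x: "support_point K v \<in> U"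
  shows "boundary_chart.normal_deriv G A (support_point K v) (support_hessian K v w)
      + (G (support_point K v) \<bullet> support_hessian K v w) *\<^sub>R sgn (G (support_point K v))
    = (1 / norm v) *\<^sub>R (w - (w \<bullet> sgn v) *\<^sub>R sgn v)"
proof -
  interpret boundary_chart K U \<phi> G A by fact
  obtain D where D: "(support_point K has_derivative D) (at v)"
    and eq: "\<And>w. normal_deriv (support_point K v) (D w) + (G (support_point K v) \<bullet> D w) *\<^sub>R sgn (G (support_point K v))
      = (1 / norm v) *\<^sub>R (w - (w \<bullet> sgn v) *\<^sub>R sgn v)"
    using has_derivative_support_point_chart[OF v refl x curvature_pos[OF support_point_frontier[OF v]]] by blast
  have "D = support_hessian K v" by (rule has_derivative_unique[OF D support_hessian_works[OF v]])
  then show ?thesis using eq by simp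
qed

text \<open>In a chart the Hessian solves a linear equation whose operator is injective by positive
  curvature and whose data vary continuously with the direction.\<close>

lemma continuous_on_support_hessian: "continuous_on (- {0}) (\<lambda>v. support_hessian K v w)"
proof (rule continuous_at_imp_continuous_on, rule ballI)
  fix v :: "real^3" assume "v \<in> - {0}"
  then have v: "v \<noteq> 0" by simp
  obtain U \<phi> G A where x: "support_point K v \<in> U" and bc: "boundary_chart K U \<phi> G A"
    using boundary_chart_ex[OF support_point_frontier[OF v]] by blast
  then interpret boundary_chart K U \<phi> G A by simp
  define V where "V = {w \<in> - {0}. support_point K w \<in> U}"
  have V: "open V" "v \<in> V"
    using continuous_open_preimage[OF continuous_on_support_point _ open_chart] v x
    by (auto simp: V_def open_Compl vimage_def Int_def)
  have cs: "continuous_on V (support_point K)"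
    by (rule continuous_on_subset[OF continuous_on_support_point]) (auto simp: V_def)
  have sV: "support_point K ` V \<subseteq> U" by (auto simp: V_def)
  have comp: "continuous_on V (\<lambda>t. f (support_point K t))" if "continuous_on U f"
    for f :: "real^3 \<Rightarrow> real^3"
    by (rule continuous_on_compose2[OF that cs sV])
  have G0: "G (support_point K t) \<noteq> 0" if "t \<in> V" for t
    using regular that by (simp add: V_def)
  have "continuous_on V (\<lambda>t. support_hessian K t w)"
  proof (rule continuous_on_linear_solution[where
      L = "\<lambda>t w. normal_deriv (support_point K t) w + (G (support_point K t) \<bullet> w) *\<^sub>R sgn (G (support_point K t))"
      and b = "\<lambda>t. (1 / norm t) *\<^sub>R (w - (w \<bullet> sgn t) *\<^sub>R sgn t)"])
    show "continuous_on V (\<lambda>t. normal_deriv (support_point K t) w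
        + (G (support_point K t) \<bullet> w) *\<^sub>R sgn (G (support_point K t)))" for w
      unfolding sgn_div_norm
      by (intro continuous_intros comp continuous_on_normal_deriv continuous_on_gradient) (use G0 in auto)
    show "continuous_on V (\<lambda>t. (1 / norm t) *\<^sub>R (w - (w \<bullet> sgn t) *\<^sub>R sgn t))"
      unfolding sgn_div_norm by (intro continuous_intros) (auto simp: V_def)
  qed (use linear_normal_deriv_plus inj_normal_deriv_plus support_point_frontier curvature_pos
      support_hessian_chart[OF bc] in \<open>auto simp: V_def\<close>)
  then show "isCont (\<lambda>v. support_hessian K v w) v"
    using V continuous_on_eq_continuous_at by blast
qed

text \<open>The right-hand side of the chart equation is orthogonal to \<open>v\<close>. Hence the
  Hessian takes values orthogonal to \<open>v\<close>, and the tangential part of the equation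
  relates it to the differential of the Gauss map. Injectivity yields the relation in the other
  order.\<close>

lemma
  assumes v: "v \<noteq> 0"
  shows gauss_map_support_point: "gauss_map K (support_point K v) = sgn v"
    and support_hessian_orthogonal: "support_hessian K v w \<bullet> v = 0"
    and weingarten_support_hessian:
      "weingarten K (support_point K v) (support_hessian K v w) = (1 / norm v) *\<^sub>R (w - (w \<bullet> sgn v) *\<^sub>R sgn v)"
    and support_hessian_weingarten:
      "w \<bullet> v = 0 \<Longrightarrow> support_hessian K v (weingarten K (support_point K v) w) = (1 / norm v) *\<^sub>R w"
proof -
  have f: "support_point K v \<in> frontier K" by (rule support_point_frontier[OF v])
  obtain U \<phi> G A where x: "support_point K v \<in> U" and bc: "boundary_chart K U \<phi> G A"
    using boundary_chart_ex[OF f] by blast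
  then interpret boundary_chart K U \<phi> G A by simp
  have n: "sgn (G (support_point K v)) = sgn v" by (rule normal_support_point[OF v x])
  have n1: "sgn v \<bullet> sgn v = 1" using v by (simp add: dot_square_norm norm_sgn)
  have "G (support_point K v) = norm (G (support_point K v)) *\<^sub>R sgn (G (support_point K v))"
    using regular[OF x] by (simp add: sgn_div_norm)
  then have G: "G (support_point K v) = norm (G (support_point K v)) *\<^sub>R sgn v"
    unfolding n .
  have vs: "v = norm v *\<^sub>R sgn v" using v by (simp add: sgn_div_norm)
  have GG: "G (support_point K v) \<bullet> z = 0 \<longleftrightarrow> z \<bullet> v = 0" for z
    using regular[OF x] v by (subst G, subst (2) vs) (simp add: inner_commute)
  show "gauss_map K (support_point K v) = sgn v" using gauss_map_eq[OF x f] n by simp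
  note eq = support_hessian_chart[OF bc v x]
  have orth: "support_hessian K v w \<bullet> v = 0" for w
  proof -
    have "(normal_deriv (support_point K v) (support_hessian K v w)
        + (G (support_point K v) \<bullet> support_hessian K v w) *\<^sub>R sgn (G (support_point K v))) \<bullet> sgn v = 0"
      unfolding eq using n1 by (simp add: inner_diff_left)
    then have "G (support_point K v) \<bullet> support_hessian K v w = 0"
      using normal_deriv_tangent[OF x] n n1 by (simp add: inner_add_left)
    then show ?thesis using GG by blast
  qed
  then show "support_hessian K v w \<bullet> v = 0" .
  have W: "weingarten K (support_point K v) z = normal_deriv (support_point K v) z" if "z \<bullet> v = 0" for z
    by (rule weingarten_eq[OF x f], unfold n) (use that in \<open>simp add: sgn_div_norm\<close>)
  have nD: "normal_deriv (support_point K v) (support_hessian K v w) = (1 / norm v) *\<^sub>R (w - (w \<bullet> sgn v) *\<^sub>R sgn v)" for w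
    using eq[of w] orth[of w] GG[of "support_hessian K v w"] by simp
  then show "weingarten K (support_point K v) (support_hessian K v w) = (1 / norm v) *\<^sub>R (w - (w \<bullet> sgn v) *\<^sub>R sgn v)"
    using W orth by simp
  show "support_hessian K v (weingarten K (support_point K v) w) = (1 / norm v) *\<^sub>R w" if w: "w \<bullet> v = 0"
  proof -
    let ?z = "normal_deriv (support_point K v) w"
    have "?z \<bullet> sgn v = 0" using normal_deriv_tangent[OF x, of w] n by simp
    \<comment> \<open>Both candidates have the same image under \<open>normal_deriv\<close> and are
      orthogonal to the gradient, so the injective map of \<open>inj_normal_deriv_plus\<close>
      identifies them.\<close>
    then have "normal_deriv (support_point K v) (support_hessian K v ?z) = normal_deriv (support_point K v) ((1 / norm v) *\<^sub>R w)"
      using nD[of ?z] linear_scale[OF linear_normal_deriv[OF x]] by simp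
    moreover have "G (support_point K v) \<bullet> support_hessian K v ?z = 0" "G (support_point K v) \<bullet> ((1 / norm v) *\<^sub>R w) = 0"
      using GG orth w by (blast, simp add: GG)
    ultimately show ?thesis
      using injD[OF inj_normal_deriv_plus[OF x f curvature_pos[OF f]], of "support_hessian K v ?z" "(1 / norm v) *\<^sub>R w"]
      by (simp add: W[OF w])
  qed
qed

section \<open>Symmetry, positivity and scaling of the Hessian\<close>

lemma support_hessian_symmetric:
  assumes "v \<noteq> 0"
  shows "support_hessian K v a \<bullet> b = support_hessian K v b \<bullet> a"
  by (rule symmetric_second_derivative[OF _ _ has_derivative_support_fun support_hessian_works, of "- {0}"])
    (use assms in \<open>auto simp: open_Compl\<close>)

text \<open>By symmetry the squared length of \<open>support_hessian K v v\<close> is the product of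
  a Hessian value with \<open>v\<close>, which vanishes.\<close>

lemma support_hessian_radial:
  assumes "v \<noteq> 0"
  shows "support_hessian K v v = 0"
proof -
  have "support_hessian K v v \<bullet> support_hessian K v v = 0"
    using support_hessian_symmetric[OF assms, of v "support_hessian K v v"]
      support_hessian_orthogonal[OF assms] by simp
  then show ?thesis by simp
qed

text \<open>A convex function has a monotone gradient; a negative value would make the support point
  move against \<open>w\<close> along the ray in direction \<open>w\<close>.\<close>

lemma support_hessian_nonneg:
  assumes v: "v \<noteq> 0"
  shows "0 \<le> support_hessian K v w \<bullet> w"
proof (rule ccontr)
  assume neg: "\<not> ?thesis"
  have "((\<lambda>s. v + s *\<^sub>R w) has_derivative (\<lambda>s. s *\<^sub>R w)) (at 0)"
    by (auto intro!: derivative_eq_intros)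
  from diff_chain_at[OF this, of "support_point K" "support_hessian K v"] support_hessian_works[OF v]
  have "((\<lambda>s. support_point K (v + s *\<^sub>R w)) has_derivative (\<lambda>s. support_hessian K v (s *\<^sub>R w))) (at 0)"
    by (simp add: o_def)
  from has_derivative_inner_left[OF this, of w]
  have "((\<lambda>s. support_point K (v + s *\<^sub>R w) \<bullet> w) has_real_derivative support_hessian K v w \<bullet> w) (at 0)"
    using linear_scale[OF linear_support_hessian[OF v]]
    by (simp add: has_field_derivative_def mult.commute[of _ "_ \<bullet> w"])
  from DERIV_neg_dec_right[OF this] neg obtain d where "d > 0"
    "\<And>s. 0 < s \<Longrightarrow> s < d \<Longrightarrow> support_point K (v + s *\<^sub>R w) \<bullet> w < support_point K v \<bullet> w"
    by auto
  then have "\<forall>\<^sub>F s in at_right 0. support_point K (v + s *\<^sub>R w) \<bullet> w < support_point K v \<bullet> w"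
    by (auto simp: eventually_at_right_field)
  moreover have "\<forall>\<^sub>F s in at_right (0::real). v + s *\<^sub>R w \<in> - {0}"
    by (rule eventually_ray_in_open) (use v in \<open>auto simp: open_Compl\<close>)
  ultimately have "\<forall>\<^sub>F s in at_right (0::real). False"
    using eventually_at_right_less[of 0]
  proof eventually_elim
    case (elim s)
    then have "0 \<le> s * ((support_point K (v + s *\<^sub>R w) - support_point K v) \<bullet> w)"
      using support_point_monotone[OF v, of "v + s *\<^sub>R w"] by simp
    then show ?case using elim by (simp add: zero_le_mult_iff inner_diff_left)
  qed
  then show False by simp
qed

text \<open>A nonnegative symmetric form that vanishes at \<open>w\<close> has \<open>w\<close> in
  its kernel. The differential of the Gauss map, which recovers the tangential part of
  \<open>w\<close>, would then make that part zero.\<close>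

lemma support_hessian_pos:
  assumes v: "v \<noteq> 0" and w: "w - (w \<bullet> sgn v) *\<^sub>R sgn v \<noteq> 0"
  shows "0 < support_hessian K v w \<bullet> w"
proof (rule ccontr)
  interpret linear "support_hessian K v" by (rule linear_support_hessian[OF v])
  define z where "z = support_hessian K v w"
  define b where "b = support_hessian K v z \<bullet> z"
  assume "\<not> ?thesis"
  then have 0: "z \<bullet> w = 0" using support_hessian_nonneg[OF v, of w] by (simp add: z_def)
  have b: "b \<ge> 0" using support_hessian_nonneg[OF v] by (simp add: b_def)
  have zz: "support_hessian K v z \<bullet> w = z \<bullet> z" using support_hessian_symmetric[OF v, of z w] by (simp add: z_def)
  \<comment> \<open>Nearly the minimizer of the quadratic polynomial in \<open>s\<close> below; the
    added 1 avoids a zero denominator.\<close>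
  define s where "s = (z \<bullet> z) / (b + 1)"
  have "0 \<le> support_hessian K v (w - s *\<^sub>R z) \<bullet> (w - s *\<^sub>R z)" by (rule support_hessian_nonneg[OF v])
  also have "\<dots> = (z - s *\<^sub>R support_hessian K v z) \<bullet> (w - s *\<^sub>R z)" by (simp add: diff scale z_def)
  also have "\<dots> = s * (s * b - 2 * (z \<bullet> z))"
    using 0 zz by (simp add: inner_diff_left inner_diff_right b_def algebra_simps)
  finally have le: "0 \<le> s * (s * b - 2 * (z \<bullet> z))" .
  have "z = 0"
  proof (rule ccontr)
    assume "z \<noteq> 0"
    then have pos: "z \<bullet> z > 0" "s > 0" using b by (simp_all add: s_def)
    then have "2 * (z \<bullet> z) \<le> s * b" using le by (simp add: zero_le_mult_iff)
    also have "\<dots> \<le> s * (b + 1)" using pos by simp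
    also have "\<dots> = z \<bullet> z" using b by (simp add: s_def)
    finally show False using pos by simp
  qed
  then have "weingarten K (support_point K v) 0 = (1 / norm v) *\<^sub>R (w - (w \<bullet> sgn v) *\<^sub>R sgn v)"
    using weingarten_support_hessian[OF v, of w] by (simp add: z_def)
  moreover have "weingarten K (support_point K v) 0 = 0"
    using weingarten_support_hessian[OF v, of 0] by (simp add: zero)
  ultimately show False using w v by simp
qed

text \<open>Support points are homogeneous of degree 0, so their derivative is homogeneous of degree
  -1.\<close>

lemma support_hessian_scaleR:
  assumes v: "v \<noteq> 0" and c: "c > 0"
  shows "support_hessian K (c *\<^sub>R v) w = support_hessian K v w /\<^sub>R c"
proof -
  have cv: "c *\<^sub>R v \<noteq> 0" using v c by simp
  have "((\<lambda>y. c *\<^sub>R y) has_derivative (\<lambda>w. c *\<^sub>R w)) (at v)" by (auto intro!: derivative_eq_intros)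
  from diff_chain_at[OF this support_hessian_works[OF cv]]
  have "((\<lambda>y. support_point K (c *\<^sub>R y)) has_derivative (\<lambda>w. support_hessian K (c *\<^sub>R v) (c *\<^sub>R w))) (at v)"
    by (simp add: o_def)
  then have "(support_point K has_derivative (\<lambda>w. support_hessian K (c *\<^sub>R v) (c *\<^sub>R w))) (at v)"
    by (rule has_derivative_transform_within_open[of _ _ _ _ "- {0}"])
      (use v c in \<open>auto simp: open_Compl support_point_scaleR\<close>)
  from fun_cong[OF has_derivative_unique[OF this support_hessian_works[OF v]], of w]
  have "support_hessian K v w = c *\<^sub>R support_hessian K (c *\<^sub>R v) w"
    using linear_scale[OF linear_support_hessian[OF cv], of c w] by simp
  then show ?thesis using c by simp
qed

section \<open>Spherical curvature and principal radii\<close>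

text \<open>The spherical gradient is the support point minus its radial part. Up to a radial term,
  its derivative is the Euclidean Hessian minus \<open>support_fun K \<omega>\<close> times the
  identity, which the metric term restores.\<close>

lemma sph_curvature_eq:
  assumes \<omega>: "norm \<omega> = 1" and X: "X \<bullet> \<omega> = 0" and Y: "Y \<bullet> \<omega> = 0"
  shows "sph_curvature K \<omega> X Y = support_hessian K \<omega> X \<bullet> Y"
proof -
  have nz: "z \<noteq> 0" if "norm z = 1" for z :: "real^3" using that by auto
  define G where "G z = support_point K z - support_fun K z *\<^sub>R z" for z
  have hG: "(support_fun K has_derivative (\<lambda>w. G z \<bullet> w)) (at z within sphere 0 1)" if z: "norm z = 1" for z
  proof -
    \<comment> \<open>\<open>norm y - 1\<close> vanishes on the sphere; subtracting a multiple of it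
      makes the gradient tangent without changing the restriction.\<close>
    have "((\<lambda>y. norm y) has_derivative (\<lambda>w. w \<bullet> z)) (at z)"
      using has_derivative_norm[OF nz[OF z]] z by (simp add: sgn_div_norm)
    from has_derivative_diff[OF has_derivative_support_fun[OF nz[OF z]]
        has_derivative_mult_right[OF has_derivative_diff[OF this has_derivative_const], of "support_fun K z" 1]]
    have "((\<lambda>y. support_fun K y - support_fun K z * (norm y - 1)) has_derivative (\<lambda>w. G z \<bullet> w)) (at z)"
      by (simp add: G_def inner_diff_left inner_commute[of z])
    from has_derivative_at_withinI[OF this] show ?thesis
      by (rule has_derivative_transform[rotated 2]) (use z in auto)
  qed
  have tG: "G z \<bullet> z = 0" if "norm z = 1" for z
    using that nz[OF that] by (simp add: G_def inner_diff_left dot_square_norm support_fun_eq)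
  have dG: "(G has_derivative (\<lambda>w. support_hessian K \<omega> w
      - (support_fun K \<omega> *\<^sub>R w + (support_point K \<omega> \<bullet> w) *\<^sub>R \<omega>))) (at \<omega> within sphere 0 1)"
    unfolding G_def
    by (rule has_derivative_at_withinI) (intro has_derivative_diff has_derivative_scaleR has_derivative_ident
        support_hessian_works has_derivative_support_fun nz \<omega>)
  then have dG': "G differentiable (at \<omega> within sphere 0 1)" unfolding differentiable_def by blast
  have "sph_hessian (support_fun K) \<omega> X Y = sph_deriv G \<omega> X \<bullet> tangent_field Y \<omega>"
    unfolding sph_hessian_def
    by (rule sph_hessian_field_gradient[OF hG tG dG' tangent_field_tangent tangent_field_differentiable \<omega> X])
  also have "\<dots> = support_hessian K \<omega> X \<bullet> Y - support_fun K \<omega> * (X \<bullet> Y)"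
    using sph_deriv_eq[OF dG \<omega> X] Y
    by (simp add: tangent_field_eq inner_diff_left inner_add_left inner_commute[of \<omega> Y])
  finally show ?thesis by (simp add: sph_curvature_def)
qed

lemma the_inv_into_gauss_map:
  assumes "norm \<omega> = 1"
  shows "the_inv_into (frontier K) (gauss_map K) \<omega> = support_point K \<omega>"
proof (rule the_inv_into_f_eq)
  have \<omega>: "\<omega> \<noteq> 0" using assms by auto
  show "support_point K \<omega> \<in> frontier K" by (rule support_point_frontier[OF \<omega>])
  show "gauss_map K (support_point K \<omega>) = \<omega>"
    using gauss_map_support_point[OF \<omega>] assms by (simp add: sgn_div_norm)
  show "inj_on (gauss_map K) (frontier K)"
  proof (rule inj_on_inverseI)
    fix x assume x: "x \<in> frontier K"
    then obtain U \<phi> G A where U: "x \<in> U" and "boundary_chart K U \<phi> G A"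
      using boundary_chart_ex by blast
    then interpret boundary_chart K U \<phi> G A by simp
    show "support_point K (gauss_map K x) = x"
      using gauss_map_eq[OF U x] support_point_normal[OF U x] by simp
  qed
qed

text \<open>The Hessian inverts the differential of the Gauss map, so its eigenvalue is
  \<open>1 / k\<close>; nonnegativity of the Hessian excludes negative \<open>k\<close>.\<close>

lemma principal_direction_support_hessian:
  assumes \<omega>: "norm \<omega> = 1" and X: "norm X = 1" and pd: "principal_direction K (support_point K \<omega>) X k"
  shows "k > 0" "support_hessian K \<omega> X \<bullet> X = 1 / k"
proof -
  have nz: "\<omega> \<noteq> 0" using \<omega> by auto
  interpret linear "support_hessian K \<omega>" by (rule linear_support_hessian[OF nz])
  have "X \<bullet> \<omega> = 0" "weingarten K (support_point K \<omega>) X = k *\<^sub>R X"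
    using pd gauss_map_support_point[OF nz] \<omega> by (simp_all add: principal_direction_def sgn_div_norm)
  then have "k *\<^sub>R support_hessian K \<omega> X = X"
    using support_hessian_weingarten[OF nz, of X] \<omega> by (simp add: scale)
  then have "(k *\<^sub>R support_hessian K \<omega> X) \<bullet> X = 1" using X by (simp only: norm_eq_1)
  then have 1: "k * (support_hessian K \<omega> X \<bullet> X) = 1" by simp
  then have "k \<noteq> 0" by auto
  then show "support_hessian K \<omega> X \<bullet> X = 1 / k" using 1 by (simp add: field_simps)
  show "k > 0"
  proof (rule ccontr)
    assume "\<not> k > 0"
    then have "k * (support_hessian K \<omega> X \<bullet> X) \<le> 0"
      using support_hessian_nonneg[OF nz, of X] by (intro mult_nonpos_nonneg) auto
    then show False using 1 by simp
  qed
qed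

end

subsection \<open>Slices\<close>

locale slicing = C2_convex_body +
  fixes \<nu> e1 e2 :: "real^3"
  assumes unit: "norm \<nu> = 1" "norm e1 = 1" "norm e2 = 1"
    and orthogonal: "e1 \<bullet> e2 = 0" "e1 \<bullet> \<nu> = 0" "e2 \<bullet> \<nu> = 0"
begin

definition u :: "real \<Rightarrow> real^3" where "u t = cos t *\<^sub>R e1 + sin t *\<^sub>R e2"

definition u_perp :: "real \<Rightarrow> real^3" where "u_perp t = (- sin t) *\<^sub>R e1 + cos t *\<^sub>R e2"

definition dir :: "real \<Rightarrow> real \<Rightarrow> real^3" where "dir t l = u t + l *\<^sub>R \<nu>"

lemma inner_frame:
  "u t \<bullet> u t = 1" "u_perp t \<bullet> u_perp t = 1" "\<nu> \<bullet> \<nu> = 1"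
  "u t \<bullet> u_perp t = 0" "u_perp t \<bullet> u t = 0"
  "u t \<bullet> \<nu> = 0" "\<nu> \<bullet> u t = 0" "u_perp t \<bullet> \<nu> = 0" "\<nu> \<bullet> u_perp t = 0"
proof -
  have e: "e1 \<bullet> e1 = 1" "e2 \<bullet> e2 = 1" "e2 \<bullet> e1 = 0" "\<nu> \<bullet> e1 = 0" "\<nu> \<bullet> e2 = 0"
    using unit orthogonal by (simp_all add: norm_eq_1 inner_commute)
  have cs: "cos t * cos t + sin t * sin t = 1" "sin t * sin t + cos t * cos t = 1"
    using sin_cos_squared_add[of t] by (simp_all add: power2_eq_square)
  show "\<nu> \<bullet> \<nu> = 1" using unit by (simp add: norm_eq_1)
  show "u t \<bullet> u t = 1" "u_perp t \<bullet> u_perp t = 1" "u t \<bullet> u_perp t = 0" "u_perp t \<bullet> u t = 0"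
    "u t \<bullet> \<nu> = 0" "\<nu> \<bullet> u t = 0" "u_perp t \<bullet> \<nu> = 0" "\<nu> \<bullet> u_perp t = 0"
    using e cs orthogonal
    by (simp_all add: u_def u_perp_def inner_add_left inner_add_right inner_diff_left inner_diff_right)
qed

lemma dir_inner: "dir t l \<bullet> u t = 1" "dir t l \<bullet> \<nu> = l"
  by (simp_all add: dir_def inner_add_left inner_frame)

lemma dir_nonzero: "dir t l \<noteq> 0"
  using dir_inner(1)[of t l] by auto

lemma has_derivative_u: "(u has_derivative (\<lambda>a. a *\<^sub>R u_perp t)) (at t)"
  unfolding u_def u_perp_def by (auto intro!: derivative_eq_intros simp: algebra_simps)

lemma has_derivative_u_perp: "(u_perp has_derivative (\<lambda>a. - a *\<^sub>R u t)) (at t)"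
  unfolding u_def u_perp_def by (auto intro!: derivative_eq_intros simp: algebra_simps)

section \<open>Duality for slices\<close>

text \<open>On the slice, \<open>x \<bullet> dir t l\<close> and \<open>x \<bullet> u t\<close>
  differ by the constant \<open>l * q\<close>, so they have the same maximizers there.\<close>

lemma slice_support_eq:
  assumes "support_point K (dir t l) \<bullet> \<nu> = q"
  shows "slice_support K \<nu> (u t) q = support_point K (dir t l) \<bullet> u t"
  unfolding slice_support_def
proof (rule cSup_eq_maximum)
  show "support_point K (dir t l) \<bullet> u t \<in> (\<lambda>x. x \<bullet> u t) ` {x \<in> K. x \<bullet> \<nu> = q}"
    using support_point_in[OF dir_nonzero] assms by blast
  fix z assume "z \<in> (\<lambda>x. x \<bullet> u t) ` {x \<in> K. x \<bullet> \<nu> = q}"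
  then obtain y where y: "y \<in> K" "y \<bullet> \<nu> = q" "z = y \<bullet> u t" by blast
  show "z \<le> support_point K (dir t l) \<bullet> u t"
    using support_point_max[OF dir_nonzero[of t l] y(1)] y assms
    by (simp add: dir_def inner_add_right)
qed

text \<open>Lagrange duality with multiplier \<open>l\<close>: the support point for
  \<open>dir t l\<close> lies in the slice and tests the bound for every other multiplier. Equality
  makes it the support point for \<open>dir t l'\<close> as well.\<close>

lemma slice_duality:
  assumes "support_point K (dir t l) \<bullet> \<nu> = q"
  shows "slice_support K \<nu> (u t) q = support_fun K (dir t l) - l * q"
    and "slice_support K \<nu> (u t) q \<le> support_fun K (dir t l') - l' * q"
    and "support_fun K (dir t l') - l' * q = slice_support K \<nu> (u t) q \<Longrightarrow> l' = l"
proof -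
  define x where "x = support_point K (dir t l)"
  have x: "x \<in> K" "x \<bullet> \<nu> = q" "slice_support K \<nu> (u t) q = x \<bullet> u t"
    using assms slice_support_eq[OF assms] support_point_in[OF dir_nonzero] by (simp_all add: x_def)
  have xd: "x \<bullet> dir t k = x \<bullet> u t + k * q" for k using x by (simp add: dir_def inner_add_right)
  show "slice_support K \<nu> (u t) q = support_fun K (dir t l) - l * q"
    using xd[of l] x by (simp add: support_fun_eq[OF dir_nonzero] flip: x_def)
  show "slice_support K \<nu> (u t) q \<le> support_fun K (dir t l') - l' * q"
    using xd[of l'] x support_point_max[OF dir_nonzero[of t l'] x(1)]
    by (simp add: support_fun_eq[OF dir_nonzero])
  assume "support_fun K (dir t l') - l' * q = slice_support K \<nu> (u t) q"
  then have "support_point K (dir t l') \<bullet> dir t l' = x \<bullet> dir t l'"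
    using xd[of l'] x by (simp add: support_fun_eq[OF dir_nonzero])
  then have "support_point K (dir t l') = x"
    using support_point_max[OF dir_nonzero[of t l']] x by (intro support_point_eqI dir_nonzero) auto
  \<comment> \<open>One support point has one unit normal, so the directions are positive multiples
    of each other; both have component 1 along \<open>u t\<close>, so the factor is 1.\<close>
  then have "sgn (dir t l') = sgn (dir t l)"
    using gauss_map_support_point[OF dir_nonzero] x_def by metis
  then have "norm (dir t l') *\<^sub>R sgn (dir t l') = norm (dir t l') *\<^sub>R sgn (dir t l)" by simp
  then have eq: "dir t l' = (norm (dir t l') / norm (dir t l)) *\<^sub>R dir t l"
    using dir_nonzero[of t l'] by (simp add: sgn_div_norm divide_inverse)
  have r: "norm (dir t l') / norm (dir t l) = 1"
    using arg_cong[OF eq, of "\<lambda>z. z \<bullet> u t"] by (simp only: dir_inner inner_scaleR_left)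
  have "dir t l' = dir t l" using eq unfolding r scaleR_one .
  then show "l' = l" using dir_inner(2) by metis
qed

lemma slice_parameter_inject:
  assumes "support_point K (dir t l) \<bullet> \<nu> = support_point K (dir t l') \<bullet> \<nu>"
  shows "l = l'"
  using slice_duality(1)[OF assms] slice_duality(3)[of t l' _ l, OF refl] assms by simp

lemma continuous_on_dir: "continuous_on S (dir t)"
  unfolding dir_def by (intro continuous_intros)

text \<open>Comparison with points of \<open>K\<close> above and below the level \<open>p\<close>
  shows that the height of the support point is at least \<open>p\<close> for some positive
  \<open>l\<close> and at most \<open>p\<close> for some negative one; the intermediate value
  theorem does the rest.\<close>

lemma slice_parameter_ex:
  assumes p: "p \<in> {INF y\<in>K. y \<bullet> \<nu> <..< SUP y\<in>K. y \<bullet> \<nu>}"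
  shows "\<exists>l. support_point K (dir t l) \<bullet> \<nu> = p"
proof -
  obtain B where B: "B > 0" "\<And>y. y \<in> K \<Longrightarrow> norm y \<le> B"
    using compact_imp_bounded[OF compact] unfolding bounded_pos by blast
  have bd: "\<bar>y \<bullet> w\<bar> \<le> B * norm w" if "y \<in> K" for y w
    using Cauchy_Schwarz_ineq2[of y w] B(2)[OF that] by (meson mult_right_mono norm_ge_zero order_trans)
  have u1: "norm (u t) = 1" by (simp add: norm_eq_1 inner_frame)
  have "bdd_above ((\<lambda>y. y \<bullet> \<nu>) ` K)" "bdd_below ((\<lambda>y. y \<bullet> \<nu>) ` K)"
    using bd[of _ \<nu>] unit by (auto intro!: bdd_aboveI2[where M = B] bdd_belowI2[where m = "- B"] simp: abs_le_iff minus_le_iff)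
  then obtain y1 y2 where y1: "y1 \<in> K" "p < y1 \<bullet> \<nu>" and y2: "y2 \<in> K" "y2 \<bullet> \<nu> < p"
    using p less_cSUP_iff[OF nonempty] cINF_less_iff[OF nonempty] by (metis greaterThanLessThan_iff)
  have ge: "y \<bullet> \<nu> * l - 2 * B \<le> (support_point K (dir t l) \<bullet> \<nu>) * l" if "y \<in> K" for y l
    using support_point_max[OF dir_nonzero[of t l] that] bd[OF that, of "u t"] u1
      bd[OF support_point_in[OF dir_nonzero[of t l]], of "u t"]
    by (simp add: dir_def inner_add_right mult.commute)
  \<comment> \<open>Chosen so that \<open>(y1 \<bullet> \<nu> - p) * l1\<close> equals the error
    \<open>2 * B\<close> in \<open>ge\<close>, and likewise for \<open>l2\<close> with
    \<open>y2\<close>.\<close>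
  define l1 where "l1 = 2 * B / (y1 \<bullet> \<nu> - p)"
  define l2 where "l2 = - (2 * B / (p - y2 \<bullet> \<nu>))"
  have l: "l2 < 0" "0 < l1" using B y1 y2 by (simp_all add: l1_def l2_def)
  have "(y1 \<bullet> \<nu> - p) * l1 = 2 * B" "(y2 \<bullet> \<nu> - p) * l2 = 2 * B"
    using y1 y2 by (simp_all add: l1_def l2_def field_simps)
  then have "0 \<le> (support_point K (dir t l1) \<bullet> \<nu> - p) * l1" "0 \<le> (support_point K (dir t l2) \<bullet> \<nu> - p) * l2"
    using ge[OF y1(1), of l1] ge[OF y2(1), of l2] by (simp_all add: left_diff_distrib)
  then have "p \<le> support_point K (dir t l1) \<bullet> \<nu>" "support_point K (dir t l2) \<bullet> \<nu> \<le> p"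
    using l by (simp_all add: zero_le_mult_iff)
  moreover have "continuous_on {l2..l1} (\<lambda>l. support_point K (dir t l) \<bullet> \<nu>)"
    by (intro continuous_intros continuous_on_compose2[OF continuous_on_support_point continuous_on_dir])
      (use dir_nonzero in auto)
  ultimately show ?thesis
    using IVT'[of "\<lambda>l. support_point K (dir t l) \<bullet> \<nu>" l2 p l1] l by auto
qed

text \<open>The minimizer, encoded by its critical point equation because this can be
  differentiated. The paired argument allows total derivatives in both variables.\<close>

definition lambda :: "real \<times> real \<Rightarrow> real" where
  "lambda = (\<lambda>(t, q). THE l. support_point K (dir t l) \<bullet> \<nu> = q)"

lemma lambda_eqI: "support_point K (dir t l) \<bullet> \<nu> = q \<Longrightarrow> lambda (t, q) = l"
  unfolding lambda_def using slice_parameter_inject by (auto intro!: the_equality)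

abbreviation slice_range :: "real set" where
  "slice_range \<equiv> {INF y\<in>K. y \<bullet> \<nu> <..< SUP y\<in>K. y \<bullet> \<nu>}"

lemma lambda_works: "q \<in> slice_range \<Longrightarrow> support_point K (dir t (lambda (t, q))) \<bullet> \<nu> = q"
  using slice_parameter_ex lambda_eqI by metis

definition normal_at :: "real \<times> real \<Rightarrow> real^3" where
  "normal_at z = dir (fst z) (lambda z)"

definition hess :: "real \<times> real \<Rightarrow> real^3 \<Rightarrow> real^3 \<Rightarrow> real" where
  "hess z a b = support_hessian K (normal_at z) a \<bullet> b"

lemma normal_at_nonzero: "normal_at z \<noteq> 0"
  by (simp add: normal_at_def dir_nonzero)

lemma hess_commute: "hess z a b = hess z b a"
  unfolding hess_def by (rule support_hessian_symmetric[OF normal_at_nonzero])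

text \<open>\<open>\<nu>\<close> is orthogonal to \<open>u\<close>, whereas
  \<open>normal_at z\<close> has component 1 along \<open>u\<close>, so the two are not
  parallel.\<close>

lemma hess_\<nu>_pos: "hess z \<nu> \<nu> > 0"
  unfolding hess_def
proof (rule support_hessian_pos[OF normal_at_nonzero])
  show "\<nu> - (\<nu> \<bullet> sgn (normal_at z)) *\<^sub>R sgn (normal_at z) \<noteq> 0"
  proof
    let ?v = "normal_at z"
    assume eq: "\<nu> - (\<nu> \<bullet> sgn ?v) *\<^sub>R sgn ?v = 0"
    have "?v \<bullet> u (fst z) = 1" by (simp add: normal_at_def dir_inner)
    then have "sgn ?v \<bullet> u (fst z) \<noteq> 0" using normal_at_nonzero[of z] by (simp add: sgn_div_norm)
    moreover have "(\<nu> - (\<nu> \<bullet> sgn ?v) *\<^sub>R sgn ?v) \<bullet> u (fst z) = 0" by (simp add: eq)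
    ultimately have "\<nu> \<bullet> sgn ?v = 0" by (simp add: inner_diff_left inner_frame)
    then show False using eq unit by simp
  qed
qed

section \<open>Derivatives of the minimizer and of the slice function\<close>

lemma has_derivative_dir:
  "((\<lambda>z. dir (fst z) (snd z)) has_derivative (\<lambda>(a, b). a *\<^sub>R u_perp t + b *\<^sub>R \<nu>)) (at (t, l))"
proof -
  have "((\<lambda>z. u (fst z)) has_derivative (\<lambda>z. fst z *\<^sub>R u_perp t)) (at (t, l))"
    using diff_chain_at[OF has_derivative_fst[OF has_derivative_ident], of u "\<lambda>a. a *\<^sub>R u_perp t" "(t, l)"]
      has_derivative_u[of t] by (simp add: o_def)
  from has_derivative_add[OF this has_derivative_scaleR_left[OF has_derivative_snd[OF has_derivative_ident]]]
  show ?thesis by (simp add: dir_def case_prod_unfold)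
qed

text \<open>Implicit differentiation, carried out by inverting \<open>T\<close>, which keeps the
  angle and sends the multiplier to the height of the support point. Its derivative is triangular
  with diagonal entries 1 and \<open>c\<close>.\<close>

lemma has_derivative_lambda:
  assumes q: "q \<in> slice_range"
  shows "(lambda has_derivative
    (\<lambda>(a, b). - (hess (t, q) (u_perp t) \<nu> / hess (t, q) \<nu> \<nu>) * a + 1 / hess (t, q) \<nu> \<nu> * b)) (at (t, q))"
proof -
  define T where "T z = (fst z, support_point K (dir (fst z) (snd z)) \<bullet> \<nu>)" for z
  define g where "g z = (fst z, lambda z)" for z
  define c where "c = hess (t, q) \<nu> \<nu>"
  define d where "d = hess (t, q) (u_perp t) \<nu>"
  have c: "c \<noteq> 0" using hess_\<nu>_pos[of "(t, q)"] by (simp add: c_def)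
  have nl: "normal_at (t, q) = dir t (lambda (t, q))" by (simp add: normal_at_def)
  have "(g has_derivative (\<lambda>z. (fst z, (snd z - d * fst z) / c))) (at (t, q))"
  proof (rule has_derivative_inverse_strong_x[where f = T and S = UNIV])
    have "continuous_on UNIV (\<lambda>z::real \<times> real. dir (fst z) (snd z))"
      unfolding dir_def u_def by (intro continuous_intros)
    then show "continuous_on UNIV T" unfolding T_def
      by (intro continuous_intros continuous_on_compose2[OF continuous_on_support_point]) (auto simp: dir_nonzero)
    show "g (T z) = z" for z using lambda_eqI[of "fst z" "snd z"] by (simp add: g_def T_def)
    show "T (g (t, q)) = (t, q)" using lambda_works[OF q] by (simp add: T_def g_def)
    interpret linear "support_hessian K (normal_at (t, q))"
      by (rule linear_support_hessian[OF normal_at_nonzero])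
    from diff_chain_at[OF has_derivative_dir[of t "lambda (t, q)"], of "support_point K" "support_hessian K (normal_at (t, q))"]
    have "((\<lambda>z. support_point K (dir (fst z) (snd z))) has_derivative
        (\<lambda>(a, b). support_hessian K (normal_at (t, q)) (a *\<^sub>R u_perp t + b *\<^sub>R \<nu>))) (at (t, lambda (t, q)))"
      using support_hessian_works[OF normal_at_nonzero[of "(t, q)"]] by (simp add: o_def nl case_prod_unfold)
    from has_derivative_Pair[OF has_derivative_fst[OF has_derivative_ident] has_derivative_inner_left[OF this, of \<nu>]]
    show "(T has_derivative (\<lambda>z. (fst z, d * fst z + c * snd z))) (at (g (t, q)))"
      by (simp add: T_def[abs_def] g_def case_prod_unfold add scale c_def d_def hess_def inner_add_left mult.commute)
    show "(\<lambda>z. (fst z, d * fst z + c * snd z)) \<circ> (\<lambda>z. (fst z, (snd z - d * fst z) / c)) = id"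
      using c by (auto simp: fun_eq_iff)
  qed auto
  from has_derivative_snd[OF this] show ?thesis
    using c by (simp add: g_def case_prod_unfold diff_divide_distrib flip: c_def d_def)
qed

lemma has_derivative_normal_at:
  assumes q: "q \<in> slice_range"
  shows "(normal_at has_derivative (\<lambda>(a, b). a *\<^sub>R u_perp t +
    (- (hess (t, q) (u_perp t) \<nu> / hess (t, q) \<nu> \<nu>) * a + 1 / hess (t, q) \<nu> \<nu> * b) *\<^sub>R \<nu>)) (at (t, q))"
proof -
  let ?L = "\<lambda>(a, b). - (hess (t, q) (u_perp t) \<nu> / hess (t, q) \<nu> \<nu>) * a + 1 / hess (t, q) \<nu> \<nu> * b"
  have "((\<lambda>z. (fst z, lambda z)) has_derivative (\<lambda>z. (fst z, ?L z))) (at (t, q))"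
    by (intro has_derivative_Pair has_derivative_fst has_derivative_ident has_derivative_lambda[OF q])
  from diff_chain_at[OF this, of "\<lambda>z. dir (fst z) (snd z)", unfolded fst_conv, OF has_derivative_dir]
  show ?thesis by (simp add: o_def normal_at_def[abs_def] case_prod_unfold)
qed

lemma has_derivative_support_point_normal_at:
  assumes q: "q \<in> slice_range"
  shows "((\<lambda>z. support_point K (normal_at z)) has_derivative (\<lambda>(a, b).
    support_hessian K (normal_at (t, q)) (a *\<^sub>R u_perp t +
    (- (hess (t, q) (u_perp t) \<nu> / hess (t, q) \<nu> \<nu>) * a + 1 / hess (t, q) \<nu> \<nu> * b) *\<^sub>R \<nu>))) (at (t, q))"
  using diff_chain_at[OF has_derivative_normal_at[OF q, of t] support_hessian_works[OF normal_at_nonzero]]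
  by (simp add: o_def case_prod_unfold)

definition slice_fun :: "real \<times> real \<Rightarrow> real" where
  "slice_fun z = slice_support K \<nu> (u (fst z)) (snd z)"

lemma slice_fun_eq:
  assumes "q \<in> slice_range"
  shows "slice_fun (t, q) = support_fun K (normal_at (t, q)) - lambda (t, q) * q"
    and "slice_fun (t, q) = support_point K (normal_at (t, q)) \<bullet> u t"
  using slice_duality(1)[OF lambda_works[OF assms, of t]] slice_support_eq[OF lambda_works[OF assms, of t]]
  by (simp_all add: slice_fun_def normal_at_def)

text \<open>An envelope argument: the derivatives of \<open>lambda\<close> cancel because the
  support point has height \<open>q\<close>.\<close>

lemma has_derivative_slice_fun:
  assumes q: "q \<in> slice_range"
  shows "(slice_fun has_derivative
    (\<lambda>(a, b). (support_point K (normal_at (t, q)) \<bullet> u_perp t) * a + (- lambda (t, q)) * b)) (at (t, q))"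
proof -
  let ?x = "support_point K (normal_at (t, q))"
  have x\<nu>: "?x \<bullet> \<nu> = q" using lambda_works[OF q] by (simp add: normal_at_def)
  have 1: "((\<lambda>z. support_fun K (normal_at z)) has_derivative (\<lambda>(a, b).
    ?x \<bullet> (a *\<^sub>R u_perp t +
    (- (hess (t, q) (u_perp t) \<nu> / hess (t, q) \<nu> \<nu>) * a + 1 / hess (t, q) \<nu> \<nu> * b) *\<^sub>R \<nu>))) (at (t, q))"
    using diff_chain_at[OF has_derivative_normal_at[OF q, of t] has_derivative_support_fun[OF normal_at_nonzero]]
    by (simp add: o_def case_prod_unfold)
  have 2: "((\<lambda>z. lambda z * snd z) has_derivative (\<lambda>(a, b). lambda (t, q) * b +
    (- (hess (t, q) (u_perp t) \<nu> / hess (t, q) \<nu> \<nu>) * a + 1 / hess (t, q) \<nu> \<nu> * b) * q)) (at (t, q))"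
    using has_derivative_mult[OF has_derivative_lambda[OF q, of t] has_derivative_snd[OF has_derivative_ident]]
    by (simp add: case_prod_unfold)
  have "((\<lambda>z. support_fun K (normal_at z) - lambda z * snd z) has_derivative
      (\<lambda>(a, b). (?x \<bullet> u_perp t) * a + (- lambda (t, q)) * b)) (at (t, q))"
    using has_derivative_diff[OF 1 2] x\<nu> by (simp add: case_prod_unfold inner_add_right algebra_simps)
  then show ?thesis
    by (rule has_derivative_transform_within_open[where s = "UNIV \<times> slice_range"])
      (use q in \<open>auto simp: open_Times slice_fun_eq\<close>)
qed

text \<open>The derivative of \<open>u_perp\<close> is minus \<open>u\<close>; this produces minus
  the slice value, which the summand \<open>H\<close> of the operator cancels.\<close>

lemma has_derivative_slice_fun_theta:
  assumes q: "q \<in> slice_range"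
  shows "((\<lambda>z. support_point K (normal_at z) \<bullet> u_perp (fst z)) has_derivative
    (\<lambda>(a, b). (hess (t, q) (u_perp t) (u_perp t) - (hess (t, q) (u_perp t) \<nu>)\<^sup>2 / hess (t, q) \<nu> \<nu>
        - support_point K (normal_at (t, q)) \<bullet> u t) * a
      + (hess (t, q) (u_perp t) \<nu> / hess (t, q) \<nu> \<nu>) * b)) (at (t, q))"
proof -
  interpret linear "support_hessian K (normal_at (t, q))"
    by (rule linear_support_hessian[OF normal_at_nonzero])
  have eq: "hess (t, q) (a *\<^sub>R u_perp t + r *\<^sub>R \<nu>) (u_perp t)
      = a * hess (t, q) (u_perp t) (u_perp t) + r * hess (t, q) (u_perp t) \<nu>" for a r
    unfolding hess_commute[of _ "u_perp t" \<nu>] by (simp add: hess_def add scale inner_add_left)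
  have "((\<lambda>z. u_perp (fst z)) has_derivative (\<lambda>z. - fst z *\<^sub>R u t)) (at (t, q))"
    using diff_chain_at[OF has_derivative_fst[OF has_derivative_ident], of u_perp "\<lambda>a. - a *\<^sub>R u t" "(t, q)"]
      has_derivative_u_perp[of t] by (simp add: o_def)
  from has_derivative_inner[OF has_derivative_support_point_normal_at[OF q] this]
  show ?thesis
    by (rule has_derivative_eq_rhs)
      (simp only: fun_eq_iff split_paired_All prod.case fst_conv hess_def[symmetric] eq inner_scaleR_right,
        simp add: power2_eq_square add_divide_distrib diff_divide_distrib algebra_simps)
qed

lemma has_derivative_minus_lambda:
  assumes q: "q \<in> slice_range"
  shows "((\<lambda>z. - lambda z) has_derivative
    (\<lambda>(a, b). (hess (t, q) (u_perp t) \<nu> / hess (t, q) \<nu> \<nu>) * a + (- 1 / hess (t, q) \<nu> \<nu>) * b)) (at (t, q))"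
  by (rule has_derivative_eq_rhs[OF has_derivative_minus[OF has_derivative_lambda[OF q]]])
    (auto simp: fun_eq_iff)

lemma continuous_on_normal_at: "continuous_on (UNIV \<times> slice_range) normal_at"
  by (rule continuous_at_imp_continuous_on) (auto intro: has_derivative_continuous[OF has_derivative_normal_at])

text \<open>Continuity of the Hessian is available for a fixed vector, so the moving first argument
  is expanded in the basis.\<close>

lemma continuous_on_hess:
  assumes "continuous_on (UNIV \<times> slice_range) X" "continuous_on (UNIV \<times> slice_range) Y"
  shows "continuous_on (UNIV \<times> slice_range) (\<lambda>z. hess z (X z) (Y z))"
proof -
  have "hess z (X z) (Y z) = (\<Sum>b\<in>Basis. (X z \<bullet> b) * (support_hessian K (normal_at z) b \<bullet> Y z))" for z
  proof -
    interpret linear "support_hessian K (normal_at z)"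
      by (rule linear_support_hessian[OF normal_at_nonzero])
    have "support_hessian K (normal_at z) (X z) = (\<Sum>b\<in>Basis. (X z \<bullet> b) *\<^sub>R support_hessian K (normal_at z) b)"
      by (subst (1) euclidean_representation[of "X z", symmetric]) (simp add: sum scale)
    then show ?thesis by (simp add: hess_def inner_sum_left)
  qed
  moreover have "continuous_on (UNIV \<times> slice_range) (\<lambda>z. support_hessian K (normal_at z) b)" for b
    by (rule continuous_on_compose2[OF continuous_on_support_hessian continuous_on_normal_at])
      (use normal_at_nonzero in auto)
  ultimately show ?thesis by (auto intro!: continuous_intros assms)
qed

lemma
  shows C2_on_slice_fun: "C2_on (UNIV \<times> slice_range) slice_fun"
    and op_A_slice_fun: "p \<in> slice_range \<Longrightarrow> op_A (\<lambda>t q. slice_fun (t, q)) \<theta> p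
      = - (hess (\<theta>, p) (u_perp \<theta>) (u_perp \<theta>) / hess (\<theta>, p) \<nu> \<nu>)"
proof -
  define P where "P z = support_point K (normal_at z) \<bullet> u_perp (fst z)" for z
  define P1 where "P1 z = hess z (u_perp (fst z)) (u_perp (fst z))
    - (hess z (u_perp (fst z)) \<nu>)\<^sup>2 / hess z \<nu> \<nu> - support_point K (normal_at z) \<bullet> u (fst z)" for z
  define P2 where "P2 z = hess z (u_perp (fst z)) \<nu> / hess z \<nu> \<nu>" for z
  define R2 where "R2 z = - 1 / hess z \<nu> \<nu>" for z
  have nz: "hess z \<nu> \<nu> \<noteq> 0" for z using hess_\<nu>_pos[of z] by simp
  have f: "(slice_fun has_derivative (\<lambda>(a, b). P (t, q) * a + (- lambda (t, q)) * b)) (at (t, q))"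
    if "q \<in> slice_range" for t q
    using has_derivative_slice_fun[OF that, of t] by (simp only: P_def fst_conv)
  have P: "(P has_derivative (\<lambda>(a, b). P1 (t, q) * a + P2 (t, q) * b)) (at (t, q))"
    if "q \<in> slice_range" for t q
    using has_derivative_slice_fun_theta[OF that, of t] by (simp only: P_def[abs_def] P1_def P2_def fst_conv)
  have R: "((\<lambda>z. - lambda z) has_derivative (\<lambda>(a, b). P2 (t, q) * a + R2 (t, q) * b)) (at (t, q))"
    if "q \<in> slice_range" for t q
    using has_derivative_minus_lambda[OF that, of t] by (simp only: P2_def R2_def fst_conv)
  have c: "continuous_on S (\<lambda>z. u (fst z))" "continuous_on S (\<lambda>z. u_perp (fst z))"
    for S :: "(real \<times> real) set"
    unfolding u_def u_perp_def by (intro continuous_intros)+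
  have sp: "continuous_on (UNIV \<times> slice_range) (\<lambda>z. support_point K (normal_at z))"
    by (rule continuous_on_compose2[OF continuous_on_support_point continuous_on_normal_at])
      (use normal_at_nonzero in auto)
  have "continuous_on (UNIV \<times> slice_range) P1" "continuous_on (UNIV \<times> slice_range) P2"
    "continuous_on (UNIV \<times> slice_range) R2"
    unfolding P1_def P2_def R2_def
    by (intro continuous_intros continuous_on_hess c sp ballI nz)+
  then show "C2_on (UNIV \<times> slice_range) slice_fun"
    by (intro C2_on_strip[where f = slice_fun and P = P and R = "\<lambda>z. - lambda z" and ?P1.0 = P1 and ?P2.0 = P2 and ?R1.0 = P2 and ?R2.0 = R2, OF f P R]) simp_all
  assume p: "p \<in> slice_range"
  have "op_A (\<lambda>t q. slice_fun (t, q)) \<theta> p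
      = (P1 (\<theta>, p) + slice_fun (\<theta>, p)) * R2 (\<theta>, p) - (P2 (\<theta>, p))\<^sup>2"
    by (rule op_A_strip[where f = slice_fun and P = P and R = "\<lambda>z. - lambda z" and ?P1.0 = P1 and ?P2.0 = P2 and ?R1.0 = P2 and ?R2.0 = R2, OF f P R p])
  \<comment> \<open>With \<open>a\<close>, \<open>b\<close>, \<open>c\<close> the Hessian values as
    in the overview, the slice value cancels and
    \<open>(a - b^2 / c) * (- 1 / c) - (b / c)^2 = - a / c\<close>.\<close>
  then show "op_A (\<lambda>t q. slice_fun (t, q)) \<theta> p
      = - (hess (\<theta>, p) (u_perp \<theta>) (u_perp \<theta>) / hess (\<theta>, p) \<nu> \<nu>)"
    using nz[of "(\<theta>, p)"]
    by (simp add: P1_def P2_def R2_def slice_fun_eq(2)[OF p] field_simps power2_eq_square)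
qed

section \<open>Passage to the sphere\<close>

text \<open>\<open>(1 + l\<^sup>2) *\<^sub>R \<nu>\<close> splits into a multiple of
  \<open>\<tau>\<close> and a multiple of the radial vector \<open>v\<close>, which the Hessian
  annihilates. Normalizing \<open>v\<close> multiplies both Hessian values by \<open>norm v\<close>,
  which cancels in the ratio.\<close>

lemma hess_ratio:
  fixes z :: "real \<times> real"
  defines "\<tau> \<equiv> (\<nu> - lambda z *\<^sub>R u (fst z)) /\<^sub>R sqrt (1 + (lambda z)\<^sup>2)"
    and "\<omega> \<equiv> normal_at z /\<^sub>R norm (normal_at z)"
  shows "\<tau> \<bullet> \<omega> = 0" "norm \<tau> = 1" "\<tau> \<bullet> u_perp (fst z) = 0" "norm \<omega> = 1" "u_perp (fst z) \<bullet> \<omega> = 0"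
    and "hess z (u_perp (fst z)) (u_perp (fst z)) / hess z \<nu> \<nu> = (1 + (lambda z)\<^sup>2) *
      (sph_curvature K \<omega> (u_perp (fst z)) (u_perp (fst z)) / sph_curvature K \<omega> \<tau> \<tau>)"
proof -
  define l where "l = lambda z"
  define v where "v = normal_at z"
  define s where "s = sqrt (1 + l\<^sup>2)"
  have s: "s > 0" "s * s = 1 + l\<^sup>2" by (simp_all add: s_def add_pos_nonneg)
  have nz: "1 + l\<^sup>2 \<noteq> 0" using s by (metis mult_pos_pos less_irrefl)
  have v: "v \<noteq> 0" "v = u (fst z) + l *\<^sub>R \<nu>"
    using normal_at_nonzero[of z] by (simp_all add: v_def normal_at_def dir_def l_def)
  have \<tau>: "\<tau> = (\<nu> - l *\<^sub>R u (fst z)) /\<^sub>R s" by (simp add: \<tau>_def l_def s_def)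
  have \<omega>: "\<omega> = (1 / norm v) *\<^sub>R v" by (simp add: \<omega>_def v_def divide_inverse)
  have \<tau>v: "\<tau> \<bullet> v = 0"
    by (simp add: \<tau> v inner_diff_left inner_add_right inner_frame)
  then show \<tau>\<omega>: "\<tau> \<bullet> \<omega> = 0" by (simp add: \<omega>)
  have "\<tau> \<bullet> \<tau> = (1 + l\<^sup>2) / (s * s)"
    by (simp add: \<tau> inner_diff_left inner_diff_right inner_frame power2_eq_square divide_inverse)
      (simp add: algebra_simps)
  then show "norm \<tau> = 1" using s nz by (simp add: norm_eq_1)
  show "\<tau> \<bullet> u_perp (fst z) = 0" by (simp add: \<tau> inner_diff_left inner_frame)
  show \<omega>1: "norm \<omega> = 1" using v by (simp add: \<omega>)
  show u\<omega>: "u_perp (fst z) \<bullet> \<omega> = 0" by (simp add: \<omega> v(2) inner_add_right inner_frame)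
  have D\<omega>: "support_hessian K \<omega> X = norm v *\<^sub>R support_hessian K v X" for X
    using support_hessian_scaleR[OF v(1), of "1 / norm v" X] v(1) by (simp add: \<omega> divide_inverse)
  interpret linear "support_hessian K v" by (rule linear_support_hessian[OF v(1)])
  have "s *\<^sub>R \<tau> + l *\<^sub>R v = (1 + l\<^sup>2) *\<^sub>R \<nu>"
    using s by (simp add: \<tau> v(2) algebra_simps power2_eq_square)
  then have "(1 + l\<^sup>2) *\<^sub>R \<nu> = s *\<^sub>R \<tau> + l *\<^sub>R v" by simp
  then have "(1 / (1 + l\<^sup>2)) *\<^sub>R (1 + l\<^sup>2) *\<^sub>R \<nu> = (1 / (1 + l\<^sup>2)) *\<^sub>R (s *\<^sub>R \<tau> + l *\<^sub>R v)" by simp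
  then have \<nu>: "\<nu> = (1 / (s * s)) *\<^sub>R (s *\<^sub>R \<tau> + l *\<^sub>R v)" using s nz by simp
  have orth: "support_hessian K v X \<bullet> v = 0" for X by (rule support_hessian_orthogonal[OF v(1)])
  have "hess z \<nu> \<nu> = (1 / (s * s)) * (1 / (s * s)) * (support_hessian K v (s *\<^sub>R \<tau> + l *\<^sub>R v) \<bullet> (s *\<^sub>R \<tau> + l *\<^sub>R v))"
    unfolding hess_def v_def[symmetric] by (subst (1 2) \<nu>) (simp only: scale inner_scaleR_left inner_scaleR_right mult.assoc)
  also have "\<dots> = (support_hessian K v \<tau> \<bullet> \<tau>) / (s * s)"
    using s(1) by (simp add: add scale support_hessian_radial[OF v(1)] inner_add_right orth)
  finally have c: "hess z \<nu> \<nu> = (support_hessian K v \<tau> \<bullet> \<tau>) / (1 + l\<^sup>2)" using s by simp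
  show "hess z (u_perp (fst z)) (u_perp (fst z)) / hess z \<nu> \<nu> = (1 + (lambda z)\<^sup>2) *
      (sph_curvature K \<omega> (u_perp (fst z)) (u_perp (fst z)) / sph_curvature K \<omega> \<tau> \<tau>)"
    unfolding sph_curvature_eq[OF \<omega>1 u\<omega> u\<omega>] sph_curvature_eq[OF \<omega>1 \<tau>\<omega> \<tau>\<omega>] c l_def[symmetric]
    using v(1) by (simp add: D\<omega> hess_def flip: v_def)
qed

end

text \<open>\<open>deriv\<close> and \<open>THE\<close> denote values even where no derivative or
  minimizer exists; the conclusions on \<open>C2_on\<close> and on unique existence certify that
  here they are genuine.\<close>

theorem corollary7:
  fixes K :: "(real^3) set" and \<nu> e1 e2 :: "real^3" and \<theta> p :: real
    and m M lam :: real and u uperp :: "real \<Rightarrow> real^3" and v \<omega> \<tau> x :: "real^3"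
    and H :: "real \<Rightarrow> real \<Rightarrow> real" and F :: "real \<Rightarrow> real"
    and Q :: "real^3 \<Rightarrow> real^3 \<Rightarrow> real"
  assumes "strictly_convex_body K" and "C2_boundary K"
    and "\<forall>y\<in>frontier K. gauss_curvature K y > 0"
    and "norm \<nu> = 1"
    and "norm e1 = 1" and "norm e2 = 1" and "e1 \<bullet> e2 = 0" and "e1 \<bullet> \<nu> = 0" and "e2 \<bullet> \<nu> = 0"
    and "m = (INF y\<in>K. y \<bullet> \<nu>)" and "M = (SUP y\<in>K. y \<bullet> \<nu>)"
    and "u = (\<lambda>t. cos t *\<^sub>R e1 + sin t *\<^sub>R e2)"
    and "uperp = (\<lambda>t. (- sin t) *\<^sub>R e1 + cos t *\<^sub>R e2)"
    and "H = (\<lambda>t q. slice_support K \<nu> (u t) q)"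
    and "p \<in> {m<..<M}"
    and "F = (\<lambda>l. support_fun K (u \<theta> + l *\<^sub>R \<nu>) - l * p)"
    and "lam = (THE l. is_arg_min F (\<lambda>_. True) l)"
    and "v = u \<theta> + lam *\<^sub>R \<nu>" and "\<omega> = v /\<^sub>R norm v"
    and "\<tau> = (\<nu> - lam *\<^sub>R u \<theta>) /\<^sub>R sqrt (1 + lam\<^sup>2)"
    and "Q = sph_curvature K \<omega>"
    and "x = the_inv_into (frontier K) (gauss_map K) \<omega>"
  shows "C2_on (UNIV \<times> {m<..<M}) (\<lambda>(t, q). H t q) \<and>
    H \<theta> p = (INF l. F l) \<and> (\<exists>!l. is_arg_min F (\<lambda>_. True) l) \<and>
    \<tau> \<bullet> \<omega> = 0 \<and> norm \<tau> = 1 \<and> \<tau> \<bullet> uperp \<theta> = 0 \<and>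
    op_A H \<theta> p = - (1 + lam\<^sup>2) * (Q (uperp \<theta>) (uperp \<theta>) / Q \<tau> \<tau>) \<and>
    (\<forall>\<kappa>1 \<kappa>2. principal_direction K x (uperp \<theta>) \<kappa>1 \<and> principal_direction K x \<tau> \<kappa>2 \<longrightarrow>
       \<kappa>1 > 0 \<and> \<kappa>2 > 0 \<and>
       Q (uperp \<theta>) (uperp \<theta>) = 1 / \<kappa>1 \<and> Q \<tau> \<tau> = 1 / \<kappa>2 \<and>
       op_A H \<theta> p = - (1 + lam\<^sup>2) * ((1 / \<kappa>1) / (1 / \<kappa>2)) \<and>
       op_A H \<theta> p = - (1 + lam\<^sup>2) * (\<kappa>2 / \<kappa>1))"
proof -
  interpret S: slicing K \<nu> e1 e2
    by unfold_locales (use assms(1-9) in auto)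
  have range: "S.slice_range = {m<..<M}" using assms(10,11) by simp
  have p: "p \<in> S.slice_range" using assms(15) range by simp
  have u: "u = S.u" "uperp = S.u_perp"
    using assms(12,13) by (simp_all add: fun_eq_iff S.u_def S.u_perp_def)
  have H: "H t q = S.slice_fun (t, q)" for t q
    using assms(14) by (simp add: S.slice_fun_def u)
  define L where "L = S.lambda (\<theta>, p)"
  have F: "F l = support_fun K (S.dir \<theta> l) - l * p" for l
    using assms(16) by (simp add: S.dir_def u)
  have w: "support_point K (S.dir \<theta> L) \<bullet> \<nu> = p" unfolding L_def by (rule S.lambda_works[OF p])
  have Hp: "H \<theta> p = slice_support K \<nu> (S.u \<theta>) p" using assms(14) by (simp add: u)
  have HF: "H \<theta> p = F L" unfolding Hp F by (rule S.slice_duality(1)[OF w])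
  have FL: "F L \<le> F l" "F l = F L \<Longrightarrow> l = L" for l
    unfolding HF[symmetric] unfolding Hp F by (fact S.slice_duality(2,3)[OF w])+
  \<comment> \<open>The uniqueness in the duality identifies the solution \<open>L\<close> of the
    critical point equation with the minimizer of \<open>F\<close>.\<close>
  have am: "is_arg_min F (\<lambda>_. True) l \<longleftrightarrow> l = L" for l
  proof
    assume "is_arg_min F (\<lambda>_. True) l"
    then have "F l \<le> F L" by (simp add: is_arg_min_linorder)
    then show "l = L" using FL(1)[of l] by (intro FL(2)) simp
  qed (simp add: is_arg_min_linorder FL(1))
  then have lam: "lam = L" using assms(17) by simp
  have inf: "H \<theta> p = (INF l. F l)"
    unfolding HF by (rule cInf_eq_minimum[symmetric]) (use FL(1) in auto)
  have v: "v = S.normal_at (\<theta>, p)" using assms(18) by (simp add: lam L_def S.normal_at_def S.dir_def u)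
  have \<omega>: "\<omega> = S.normal_at (\<theta>, p) /\<^sub>R norm (S.normal_at (\<theta>, p))" using assms(19) v by simp
  have \<tau>: "\<tau> = (\<nu> - S.lambda (\<theta>, p) *\<^sub>R S.u \<theta>) /\<^sub>R sqrt (1 + (S.lambda (\<theta>, p))\<^sup>2)"
    using assms(20) by (simp add: lam L_def u)
  note r = S.hess_ratio[of "(\<theta>, p)", unfolded fst_conv, folded \<omega> \<tau>, folded L_def u lam]
  have "op_A H \<theta> p = op_A (\<lambda>t q. S.slice_fun (t, q)) \<theta> p" by (simp add: H[abs_def])
  then have A: "op_A H \<theta> p = - (1 + lam\<^sup>2) * (Q (uperp \<theta>) (uperp \<theta>) / Q \<tau> \<tau>)"
    using S.op_A_slice_fun[OF p, of \<theta>] r(6) unfolding assms(21) u by (simp only: mult_minus_left)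
  have C2: "C2_on (UNIV \<times> {m<..<M}) (\<lambda>(t, q). H t q)"
    using S.C2_on_slice_fun by (simp add: H range case_prod_unfold)
  have x: "x = support_point K \<omega>" using S.the_inv_into_gauss_map[OF r(4)] assms(22) by simp
  have up1: "norm (uperp \<theta>) = 1" by (simp add: u norm_eq_1 S.inner_frame)
  have "\<kappa>1 > 0 \<and> \<kappa>2 > 0 \<and> Q (uperp \<theta>) (uperp \<theta>) = 1 / \<kappa>1 \<and> Q \<tau> \<tau> = 1 / \<kappa>2 \<and>
       op_A H \<theta> p = - (1 + lam\<^sup>2) * ((1 / \<kappa>1) / (1 / \<kappa>2)) \<and>
       op_A H \<theta> p = - (1 + lam\<^sup>2) * (\<kappa>2 / \<kappa>1)"
    if pd: "principal_direction K x (uperp \<theta>) \<kappa>1" "principal_direction K x \<tau> \<kappa>2" for \<kappa>1 \<kappa>2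
  proof -
    note k = S.principal_direction_support_hessian[OF r(4) up1 pd(1)[unfolded x]]
      S.principal_direction_support_hessian[OF r(4) r(2) pd(2)[unfolded x]]
    have Q: "Q (uperp \<theta>) (uperp \<theta>) = 1 / \<kappa>1" "Q \<tau> \<tau> = 1 / \<kappa>2"
      using k(2,4) S.sph_curvature_eq[OF r(4,5,5)] S.sph_curvature_eq[OF r(4) r(1,1)]
      by (simp_all add: assms(21))
    show ?thesis using k(1,3) Q A by simp
  qed
  moreover have "\<exists>!l. is_arg_min F (\<lambda>_. True) l" by (simp add: am)
  ultimately show ?thesis using C2 inf A r(1,2,3) by (intro conjI allI impI) blast+
qed

end
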